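(* Let $\langle \mathcal{X}_I,\mathcal{B}_I,f_{JI}\rangle_{I\preceq J\in D}$ be a countably indexed projective system of Polish measurable spaces with projective limit $(\mathcal{X}_D,\mathcal{B}_D)$, let $\tilde{\mathcal{X}}$ be a Hausdorff space, $\phi:\tilde{\mathcal{X}}\to\mathcal{X}_D$ continuous and injective, and require $\phi(\tilde{\mathcal{X}})\in\mathcal{B}_D$. Write $\phi_I:=f_I\circ\phi$. Let $\langle P_I[X_I|\mathcal{C}_I]\rangle_{I\in D}$ be a projective family of probability kernels on $\mathcal{B}_I\times\Omega$. Define $\tilde\Omega\subset\Omega$ to be the set of all $\omega$ for which the family of measures $\langle P_I[\,\cdot\,|\mathcal{C}_I](\omega)\rangle_{I\in D}$ satisfies the following condition: for all $\varepsilon>0$ there is a compact set $K\subset\tilde{\mathcal{X}}$ such that $$P_I[\phi_I K|\mathcal{C}_I](\omega)>1-\varepsilon\qquad\text{for all } I\in D.$$ Then there is a unique (up to equivalence) probability kernel $\tilde P[\,\cdot\,|\tilde{\mathcal{C}}_D](\omega)$ on $\mathcal{B}(\tilde{\mathcal{X}})\times\tilde\Omega$ with the projective family as its marginals, i.e. $\phi_I\tilde P[\,\cdot\,|\tilde{\mathcal{C}}_D]=_{\text{a.e.}}P_I[\,\cdot\,|\mathcal{C}_I]$ for all $I\in D$. This probability kernel (1) is a Radon measure for each $\omega\in\tilde\Omega$; (2) is the pullback under $\phi$ of the projective limit kernel $P_D[\,\cdot\,|\mathcal{C}_D]$ of the family $\langle P_I[\,\cdot\,|\mathcal{C}_I]\rangle_{I\in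 D}$, and hence a conditional probability given $\tilde{\mathcal{C}}_D=\mathcal{C}_D\cap\tilde\Omega$.
   Context: $(\Omega,\mathcal{A},\mathbb{P})$ is an abstract probability space, the common domain of all random variables; a.e. refers to $\mathbb{P}$. Projective system: $(D,\preceq)$ is a countable partially ordered directed set; for each $I\in D$, $\mathcal{X}_I$ is a Polish space with Borel $\sigma$-algebra $\mathcal{B}_I$, and for $I\preceq J$ the map $f_{JI}:\mathcal{X}_J\to\mathcal{X}_I$ is continuous, with $f_{II}=\mathrm{Id}$ and $f_{KI}=f_{JI}\circ f_{KJ}$ whenever $I\preceq J\preceq K$. The projective limit $\mathcal{X}_D$ is the set of all $(x_I)_{I\in D}\in\prod_I\mathcal{X}_I$ with $x_I=f_{JI}x_J$ whenever $I\preceq J$; $f_I$ is the map $(x_J)_J\mapsto x_I$; $\mathcal{X}_D$ carries the coarsest topology making all $f_I$ continuous, and $\mathcal{B}_D$ is its Borel $\sigma$-algebra. $\mathcal{B}(\tilde{\mathcal{X}})$ is the Borel $\sigma$-algebra of $\tilde{\mathcal{X}}$. $P_I[\,\cdot\,|\mathcal{C}_I](\,\cdot\,)$ is the regular conditional probability of a random variable $X_I:\Omega\to\mathcal{X}_I$ given a $\sigma$-subalgebra $\mathcal{C}_I\subset\mathcal{A}$, where $\langle\mathcal{C}_I\rangle_{I\in D}$ is directed ($\mathcal{C}_I\subset\mathcal{C}_J$ whenever $I\preceq J$). Maps act on the first argument of kernels: $(gP)[A|\cdot]:=P[g^{-1}A|\cdot]$. The family is projective if $(f_{JI}P_J)[\,\cdot\,|\mathcal{C}_J]=_{\text{a.e.}}P_I[\,\cdot\,|\mathcal{C}_I]$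 whenever $I\preceq J$. For kernels, $=_{\text{a.e.}}$ (and equivalence) means equality as measures for almost every $\omega$. The projective limit kernel $P_D[\,\cdot\,|\mathcal{C}_D]$ is the unique (up to equivalence) kernel on $\mathcal{B}_D\times\Omega$, measurable with respect to $\mathcal{C}_D:=\sigma(\mathcal{C}_I;I\in D)$, with $(f_IP_D)[\,\cdot\,|\mathcal{C}_D]=_{\text{a.e.}}P_I[\,\cdot\,|\mathcal{C}_I]$ for all $I\in D$. Pullback: a measure $\nu$ on $(\mathcal{Y},\mathcal{B}_{\mathcal{Y}})$ with $\nu^{*}(\phi(\tilde{\mathcal{X}}))=\nu(\mathcal{Y})$ ($\nu^*$ the outer measure) has as pullback under $\phi:\tilde{\mathcal{X}}\to\mathcal{Y}$ the unique measure $\tilde\nu$ on $\phi^{-1}\mathcal{B}_{\mathcal{Y}}$ with $\tilde\nu\circ\phi^{-1}=\nu$. The pullback of a kernel is taken pointwise in $\omega$. $\mathcal{C}_D\cap\tilde\Omega$ is the trace $\sigma$-algebra.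
   Formalization: Measurability of the kernel in ω is claimed only for sets in φ⁻¹B_D, not all of B(X~): for X~ = [0,1] discrete, φ = id into usual [0,1], and P(ω) = δ_ω it fails for other Borel sets of X~. When B(X~) = φ⁻¹B_D (e.g. X~ Polish) nothing is lost. *)

theory Defs
  imports "HOL-Probability.Probability"
begin

text \<open>The spaces of a projective system may differ from index to index, so topological spaces
  are represented by the type \<open>'a topology\<close> with an explicit carrier. All coordinate spaces
  share one ambient type, as in \<^const>\<open>product_topology\<close>.\<close>

definition borel_of :: "'a topology \<Rightarrow> 'a measure" where
  "borel_of T = sigma (topspace T) {U. openin T U}"

lemma space_borel_of [simp]: "space (borel_of T) = topspace T"
  by (simp add: borel_of_def space_measure_of_conv)

lemma sets_borel_of: "sets (borel_of T) = sigma_sets (topspace T) {U. openin T U}"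
  unfolding borel_of_def by (rule sets_measure_of) (auto dest: openin_subset)

definition polish_topology :: "'a topology \<Rightarrow> bool" where
  "polish_topology T \<longleftrightarrow> completely_metrizable_space T \<and> separable_space T"

text \<open>Radon measures: locally finite and inner regular with respect to compact sets. Compact sets
  are Borel because the definition is used for Hausdorff spaces only.\<close>

definition radon_measure :: "'a topology \<Rightarrow> 'a measure \<Rightarrow> bool" where
  "radon_measure T \<mu> \<longleftrightarrow>
     sets \<mu> = sets (borel_of T) \<and>
     (\<forall>x\<in>topspace T. \<exists>U. openin T U \<and> x \<in> U \<and> emeasure \<mu> U < \<infinity>) \<and>
     (\<forall>A\<in>sets \<mu>. emeasure \<mu> A = (SUP K\<in>{K. compactin T K \<and> K \<subseteq> A}. emeasure \<mu> K))"


text \<open>\<open>(I, J) \<in> r\<close> means \<open>I \<preceq> J\<close>, and then \<open>f J I\<close> maps \<open>X J\<close> to \<open>X I\<close>.\<close>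

locale polish_projective_system =
  fixes D :: "'i set" and r :: "('i \<times> 'i) set"
    and X :: "'i \<Rightarrow> 'x topology" and f :: "'i \<Rightarrow> 'i \<Rightarrow> 'x \<Rightarrow> 'x"
  assumes countable_index: "countable D"
    and index_nonempty: "D \<noteq> {}"
    and partial_order: "partial_order_on D r"
    and directed: "\<And>I J. I \<in> D \<Longrightarrow> J \<in> D \<Longrightarrow> \<exists>K\<in>D. (I, K) \<in> r \<and> (J, K) \<in> r"
    and polish: "\<And>I. I \<in> D \<Longrightarrow> polish_topology (X I)"
    and continuous: "\<And>I J. (I, J) \<in> r \<Longrightarrow> continuous_map (X J) (X I) (f J I)"
    and f_id: "\<And>I x. I \<in> D \<Longrightarrow> x \<in> topspace (X I) \<Longrightarrow> f I I x = x"
    and f_comp: "\<And>I J K x. (I, J) \<in> r \<Longrightarrow> (J, K) \<in> r \<Longrightarrow> x \<in> topspace (X K) \<Longrightarrow>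
                   f K I x = f J I (f K J x)"

definition proj_lim_set ::
    "'i set \<Rightarrow> ('i \<times> 'i) set \<Rightarrow> ('i \<Rightarrow> 'x topology) \<Rightarrow> ('i \<Rightarrow> 'i \<Rightarrow> 'x \<Rightarrow> 'x) \<Rightarrow> ('i \<Rightarrow> 'x) set" where
  "proj_lim_set D r X f =
     {x \<in> (\<Pi>\<^sub>E I\<in>D. topspace (X I)). \<forall>I J. (I, J) \<in> r \<longrightarrow> x I = f J I (x J)}"

definition proj_lim ::
    "'i set \<Rightarrow> ('i \<times> 'i) set \<Rightarrow> ('i \<Rightarrow> 'x topology) \<Rightarrow> ('i \<Rightarrow> 'i \<Rightarrow> 'x \<Rightarrow> 'x) \<Rightarrow> ('i \<Rightarrow> 'x) topology" where
  "proj_lim D r X f =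
     topology_generated_by {{x \<in> proj_lim_set D r X f. x I \<in> U} | I U. I \<in> D \<and> openin (X I) U}"

lemma topspace_proj_lim:
  assumes "D \<noteq> {}"
  shows "topspace (proj_lim D r X f) = proj_lim_set D r X f"
proof
  show "topspace (proj_lim D r X f) \<subseteq> proj_lim_set D r X f"
    by (auto simp: proj_lim_def)
  obtain I where I: "I \<in> D" using assms by auto
  show "proj_lim_set D r X f \<subseteq> topspace (proj_lim D r X f)"
  proof
    fix x assume x: "x \<in> proj_lim_set D r X f"
    then have "x I \<in> topspace (X I)" using I by (auto simp: proj_lim_set_def PiE_def)
    with x have "x \<in> {x \<in> proj_lim_set D r X f. x I \<in> topspace (X I)}" by blast
    moreover have "{x \<in> proj_lim_set D r X f. x I \<in> topspace (X I)}
        \<in> {{x \<in> proj_lim_set D r X f. x I \<in> U} | I U. I \<in> D \<and> openin (X I) U}"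
      using I openin_topspace by blast
    ultimately show "x \<in> topspace (proj_lim D r X f)"
      unfolding proj_lim_def topology_generated_by_topspace by blast
  qed
qed


text \<open>A probability kernel from \<open>C\<close> to \<open>N\<close> whose measurability in the parameter is required on
  the events of a sub-\<open>\<sigma>\<close>-algebra \<open>G\<close> of \<open>N\<close>. For \<open>G = N\<close> this is the usual notion. The
  general form is needed for kernels on the Borel sets of a Hausdorff space \<open>T\<close> that are
  pullbacks under a continuous injection \<open>\<phi>\<close> into a Polish space: pullbacks live on the \<open>\<phi>\<close>-preimages
  of Borel sets, which may be fewer than the Borel sets of \<open>T\<close>, and on the remaining Borel sets measurability
  can fail: for the identity from the discrete to the usual unit interval, the only extension of
  the Dirac kernel to the Borel sets of the discrete space, i.e. to all sets, is the Dirac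
  kernel, and \<open>\<omega> \<mapsto> \<delta>\<^sub>\<omega>(A)\<close> is the indicator of \<open>A\<close>.\<close>

definition prob_kernel :: "'w measure \<Rightarrow> 'a measure \<Rightarrow> 'a measure \<Rightarrow> ('w \<Rightarrow> 'a measure) \<Rightarrow> bool" where
  "prob_kernel C N G \<kappa> \<longleftrightarrow>
     (\<forall>\<omega>\<in>space C. prob_space (\<kappa> \<omega>) \<and> sets (\<kappa> \<omega>) = sets N) \<and>
     (\<forall>A\<in>sets G. (\<lambda>\<omega>. measure (\<kappa> \<omega>) A) \<in> borel_measurable C)"

lemma prob_kernel_iff_prob_algebra:
  assumes "sets G = sets N"
  shows "prob_kernel C N G \<kappa> \<longleftrightarrow> \<kappa> \<in> C \<rightarrow>\<^sub>M prob_algebra N"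
proof
  assume *: "prob_kernel C N G \<kappa>"
  have e: "emeasure (\<kappa> \<omega>) A = ennreal (measure (\<kappa> \<omega>) A)" if "\<omega> \<in> space C" for \<omega> A
  proof -
    interpret prob_space "\<kappa> \<omega>" using * that by (auto simp: prob_kernel_def)
    show ?thesis by (rule emeasure_eq_measure)
  qed
  show "\<kappa> \<in> C \<rightarrow>\<^sub>M prob_algebra N"
  proof (intro measurable_prob_algebraI measurable_subprob_algebra)
    fix A assume "A \<in> sets N"
    then have "(\<lambda>\<omega>. ennreal (measure (\<kappa> \<omega>) A)) \<in> borel_measurable C"
      using * assms by (auto simp: prob_kernel_def)
    then show "(\<lambda>\<omega>. emeasure (\<kappa> \<omega>) A) \<in> borel_measurable C"
      by (subst measurable_cong[OF e]) auto
  qed (use * in \<open>auto simp: prob_kernel_def prob_space_imp_subprob_space\<close>)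
next
  assume *: "\<kappa> \<in> C \<rightarrow>\<^sub>M prob_algebra N"
  then have s: "\<kappa> \<in> C \<rightarrow>\<^sub>M subprob_algebra N"
    by (rule measurable_prob_algebraD)
  show "prob_kernel C N G \<kappa>"
    unfolding prob_kernel_def
  proof (intro conjI ballI)
    fix \<omega> assume "\<omega> \<in> space C"
    then have "\<kappa> \<omega> \<in> space (prob_algebra N)" using * by (rule measurable_space[rotated])
    then show "prob_space (\<kappa> \<omega>)" "sets (\<kappa> \<omega>) = sets N" by (auto simp: space_prob_algebra)
  next
    fix A assume "A \<in> sets G"
    then have "(\<lambda>\<omega>. emeasure (\<kappa> \<omega>) A) \<in> borel_measurable C"
      using s assms by (intro measurable_emeasure_kernel) auto
    then show "(\<lambda>\<omega>. measure (\<kappa> \<omega>) A) \<in> borel_measurable C"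
      unfolding measure_def by measurable
  qed
qed

definition regular_cond_prob ::
    "'w measure \<Rightarrow> 'w measure \<Rightarrow> 'a measure \<Rightarrow> ('w \<Rightarrow> 'a) \<Rightarrow> ('w \<Rightarrow> 'a measure) \<Rightarrow> bool" where
  "regular_cond_prob M C N Y \<kappa> \<longleftrightarrow>
     subalgebra M C \<and> Y \<in> M \<rightarrow>\<^sub>M N \<and> \<kappa> \<in> C \<rightarrow>\<^sub>M prob_algebra N \<and>
     (\<forall>A\<in>sets N. AE \<omega> in M.
        measure (\<kappa> \<omega>) A = real_cond_exp M C (indicator (Y -` A \<inter> space M)) \<omega>)"

definition projective_kernels ::
    "'w measure \<Rightarrow> ('i \<times> 'i) set \<Rightarrow> ('i \<Rightarrow> 'x topology) \<Rightarrow> ('i \<Rightarrow> 'i \<Rightarrow> 'x \<Rightarrow> 'x) \<Rightarrow>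
     ('i \<Rightarrow> 'w \<Rightarrow> 'x measure) \<Rightarrow> bool" where
  "projective_kernels M r X f P \<longleftrightarrow>
     (\<forall>I J. (I, J) \<in> r \<longrightarrow> (AE \<omega> in M. distr (P J \<omega>) (borel_of (X I)) (f J I) = P I \<omega>))"

definition limit_algebra :: "'w measure \<Rightarrow> 'i set \<Rightarrow> ('i \<Rightarrow> 'w measure) \<Rightarrow> 'w measure" where
  "limit_algebra M D C = sigma (space M) (\<Union>I\<in>D. sets (C I))"

definition proj_lim_kernel ::
    "'w measure \<Rightarrow> 'i set \<Rightarrow> ('i \<times> 'i) set \<Rightarrow> ('i \<Rightarrow> 'x topology) \<Rightarrow> ('i \<Rightarrow> 'i \<Rightarrow> 'x \<Rightarrow> 'x) \<Rightarrow>
     ('i \<Rightarrow> 'w measure) \<Rightarrow> ('i \<Rightarrow> 'w \<Rightarrow> 'x measure) \<Rightarrow> ('w \<Rightarrow> ('i \<Rightarrow> 'x) measure) \<Rightarrow> bool" where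
  "proj_lim_kernel M D r X f C P PD \<longleftrightarrow>
     PD \<in> limit_algebra M D C \<rightarrow>\<^sub>M prob_algebra (borel_of (proj_lim D r X f)) \<and>
     (\<forall>I\<in>D. AE \<omega> in M. distr (PD \<omega>) (borel_of (X I)) (\<lambda>x. x I) = P I \<omega>)"

definition tight_points ::
    "'w measure \<Rightarrow> 'i set \<Rightarrow> ('i \<Rightarrow> 'w \<Rightarrow> 'x measure) \<Rightarrow> 'y topology \<Rightarrow> ('y \<Rightarrow> 'i \<Rightarrow> 'x) \<Rightarrow> 'w set" where
  "tight_points M D P T \<phi> =
     {\<omega> \<in> space M. \<forall>\<epsilon>>0. \<exists>K. compactin T K \<and>
        (\<forall>I\<in>D. measure (P I \<omega>) ((\<lambda>x. \<phi> x I) ` K) > 1 - \<epsilon>)}"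

text \<open>\<open>\<nu>'\<close> is the pullback of \<open>\<nu>\<close> under \<open>\<phi>\<close> with domain \<open>S\<close>; the outer measure condition makes
  it well defined.\<close>

definition is_pullback :: "'a set \<Rightarrow> ('a \<Rightarrow> 'b) \<Rightarrow> 'b measure \<Rightarrow> 'a measure \<Rightarrow> bool" where
  "is_pullback S \<phi> \<nu> \<nu>' \<longleftrightarrow>
     outer_measure_of \<nu> (\<phi> ` S) = emeasure \<nu> (space \<nu>) \<and>
     sets \<nu>' = sets (vimage_algebra S \<phi> \<nu>) \<and>
     (\<forall>B\<in>sets \<nu>. emeasure \<nu>' (\<phi> -` B \<inter> S) = emeasure \<nu> B)"

end

theory Submission
  imports Defs
begin

text \<open>
  The kernel on \<open>T\<close> is built one \<open>\<omega>\<close> at a time from the projective limit kernel, and everything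
  that depends on \<open>\<omega>\<close> in a measurable way is checked on the projective limit \<open>X\<^sub>D\<close> instead of on
  \<open>T\<close>.

  \<^emph>\<open>Fixed \<open>\<omega>\<close>.\<close> For a consistent family of probability measures there is exactly one measure
  \<open>\<nu>\<close> on \<open>X\<^sub>D\<close> with these marginals (\<open>limit_measure_exists\<close>, \<open>measure_on_XD_eqI\<close>): existence is
  Kolmogorov's theorem, transported to a Polish type along Borel retractions of the spaces
  \<open>X\<^sub>I\<close>; uniqueness holds because the cylinder sets \<open>{x. x I \<in> A}\<close> generate the Borel sets of \<open>X\<^sub>D\<close>
  and, the index set being directed, are stable under intersection.
  For a compact \<open>K \<subseteq> T\<close> the image \<open>\<phi> K\<close> is the intersection of the cylinders over \<open>\<phi>\<^sub>I K\<close>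
  (\<open>mem_image_if_coordinates\<close>), and along a cofinal sequence of indices these cylinders
  decrease. Hence the tightness condition, which speaks of marginals only, gives
  \<open>\<nu> (\<phi> K) \<ge> 1 - \<epsilon>\<close> (\<open>measure_compact_image_ge\<close>). So \<open>\<nu>\<close> lives on the image of a
  \<open>\<sigma>\<close>-compact set \<open>S \<subseteq> T\<close>. On each compact piece \<open>\<phi>\<close> is a homeomorphism onto its image, so
  the inverse of \<open>\<phi>\<close> on \<open>\<phi> S\<close> is Borel, and the image of \<open>\<nu>\<close> under this inverse is the unique
  measure on the Borel sets of \<open>T\<close> with image \<open>\<nu>\<close> under \<open>\<phi>\<close>. It is a Radon measure because finite
  Borel measures on Polish spaces are inner regular, and a compact subset of
  \<open>\<phi> (A \<inter> K)\<close> pulls back to a compact subset of \<open>A \<inter> K\<close> (\<open>tight_measure_lift\<close>).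

  \<^emph>\<open>Varying \<open>\<omega>\<close>.\<close> The kernels \<open>P\<^sub>I\<close> are consistent outside a null set that belongs to
  \<open>C\<^sub>D\<close>, because equality of two kernels into a Polish space is tested on countably many
  Borel sets (\<open>kernels_eq_measurable\<close>). Choosing \<open>\<nu>\<close> for every consistent \<open>\<omega>\<close> and a fixed measure for
  the others gives the projective limit kernel; its measurability need only be checked
  on cylinders, where it is the measurability of the \<open>P\<^sub>I\<close> (\<open>proj_lim_kernel_exists\<close>).
  On the \<open>\<phi>\<close>-preimages of Borel sets the lifted kernel takes the same values as the projective
  limit kernel, which gives its measurability there and the pullback property.

  \<^emph>\<open>Conditional probabilities.\<close> If \<open>Z\<close> takes values in \<open>X\<^sub>D\<close> and has coordinates \<open>Y\<^sub>I\<close>, then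
  \<open>Y\<^sub>I\<close> is a function of \<open>Y\<^sub>J\<close> whenever \<open>I\<close> precedes \<open>J\<close>, so \<open>P\<^sub>I\<close> is also a conditional distribution of
  \<open>Y\<^sub>I\<close> given \<open>C\<^sub>J\<close>, for every such \<open>J\<close>. The events of these \<open>C\<^sub>J\<close> form an intersection-stable generator of
  \<open>C\<^sub>D\<close>, so \<open>P\<^sub>I\<close> is a conditional distribution of \<open>Y\<^sub>I\<close> given \<open>C\<^sub>D\<close>
  (\<open>integral_kernel_over_CD\<close>). A second extension, from cylinders to Borel sets of \<open>X\<^sub>D\<close>, turns
  this into a statement about \<open>Z\<close> and the limit kernel (\<open>proj_lim_kernel_cond_prob\<close>).
\<close>

section \<open>Borel sets of pulled-back topologies and of Polish spaces\<close>

lemma sets_borel_of_pullback: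
  fixes T :: "'a topology" and e :: "'a \<Rightarrow> 'b::topological_space"
  assumes T: "T = pullback_topology (topspace T) e euclidean"
  shows "sets (borel_of T) = sets (vimage_algebra (topspace T) e borel)"
proof -
  have "openin T U \<longleftrightarrow> (\<exists>V. open V \<and> U = e -` V \<inter> topspace T)" for U
    using openin_pullback_topology[of "topspace T" e euclidean U] T by simp
  then have "{U. openin T U} = {e -` V \<inter> topspace T | V. open V}"
    by auto
  then show ?thesis
    unfolding borel_of_def borel_def by (subst vimage_algebra_sigma) auto
qed

lemma continuous_map_borel_of_measurable:
  assumes "continuous_map S T g"
  shows "g \<in> borel_of S \<rightarrow>\<^sub>M borel_of T"
proof (unfold borel_of_def[of T], rule measurable_measure_of)
  show "{U. openin T U} \<subseteq> Pow (topspace T)"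
    by (auto dest: openin_subset)
  show "g \<in> space (borel_of S) \<rightarrow> topspace T"
    using assms by (auto simp: continuous_map_def)
  fix U assume "U \<in> {U. openin T U}"
  then have "openin S (g -` U \<inter> topspace S)"
    using assms by (simp add: continuous_map_alt)
  then show "g -` U \<inter> space (borel_of S) \<in> sets (borel_of S)"
    by (auto simp: sets_borel_of)
qed

lemma closedin_sets_borel_of:
  assumes "closedin T A"
  shows "A \<in> sets (borel_of T)"
proof -
  have "topspace T - (topspace T - A) \<in> sets (borel_of T)"
    using assms sets.compl_sets[of "topspace T - A" "borel_of T"]
    by (auto simp: sets_borel_of closedin_def)
  moreover have "topspace T - (topspace T - A) = A"
    using closedin_subset[OF assms] by auto
  ultimately show ?thesis by simp
qed

text \<open>Measurability of the inverse of a continuous injection is tested on closed sets: their traces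
  on a compact set are compact, and continuous maps preserve compactness.\<close>
lemma measurable_borel_of_closedin:
  assumes "g \<in> space N \<rightarrow> topspace T"
    and "\<And>F. closedin T F \<Longrightarrow> g -` F \<inter> space N \<in> sets N"
  shows "g \<in> N \<rightarrow>\<^sub>M borel_of T"
proof (unfold borel_of_def, rule measurable_measure_of)
  show "{U. openin T U} \<subseteq> Pow (topspace T)"
    by (auto dest: openin_subset)
  show "g \<in> space N \<rightarrow> topspace T" by fact
  fix U assume "U \<in> {U. openin T U}"
  then have U: "openin T U" by simp
  have "space N - g -` (topspace T - U) \<inter> space N \<in> sets N"
    using assms(2)[of "topspace T - U"] U by auto
  moreover have "space N - g -` (topspace T - U) \<inter> space N = g -` U \<inter> space N"
    using assms(1) by auto
  ultimately show "g -` U \<inter> space N \<in> sets N" by simp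
qed

text \<open>The distances to a dense sequence determine a point and its neighbourhoods, because the
  points near \<open>x\<close> can be described by their distance to a member of the sequence near \<open>x\<close>. A
  sequence \<open>z\<close> of numbers is the sequence of distances from some point exactly if it satisfies
  the triangle inequalities and has values arbitrarily close to \<open>0\<close>: the members of the
  sequence at which \<open>z\<close> is small then form a Cauchy sequence, and \<open>z\<close> lists the distances
  from its limit. In this form the image is visibly a Borel set.\<close>
lemma (in Metric_space) distance_embedding:
  fixes a :: "nat \<Rightarrow> 'a"
  assumes complete: mcomplete and a: "range a \<subseteq> M"
    and dense: "mtopology closure_of range a = M"
  defines "e \<equiv> \<lambda>x n. d x (a n)"
  shows "mtopology = pullback_topology M e euclidean"
    and "inj_on e M"
    and "e ` M = (\<Inter>k. \<Inter>n. {z. \<bar>z n - d (a k) (a n)\<bar> \<le> z k}) \<inter> (\<Inter>j::nat. \<Union>k. {z. z k < inverse (Suc j)})"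
proof -
  have near: "\<exists>n. d x (a n) < r" if "x \<in> M" "r > 0" for x r
  proof -
    have "x \<in> mtopology closure_of range a" using that dense by simp
    moreover have "openin mtopology (mball x r)" "x \<in> mball x r" using that by auto
    ultimately obtain y where "y \<in> range a" "y \<in> mball x r"
      unfolding in_closure_of by blast
    then show ?thesis by auto
  qed
  have cont1: "continuous_map mtopology euclideanreal (\<lambda>x. d x (a n))" for n
  proof -
    have "a n \<in> M" using a by auto
    then show ?thesis
      unfolding continuous_map_def Pi_iff
    proof (intro conjI allI impI ballI)
      fix U :: "real set" assume U: "openin euclidean U"
      show "openin mtopology {x \<in> topspace mtopology. d x (a n) \<in> U}"
        unfolding openin_mtopology
      proof (intro conjI allI impI)
        fix x assume x: "x \<in> {x \<in> topspace mtopology. d x (a n) \<in> U}"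
        then obtain r where r: "r > 0" "ball (d x (a n)) r \<subseteq> U"
          using U by (auto simp: open_contains_ball)
        have "mball x r \<subseteq> {x \<in> topspace mtopology. d x (a n) \<in> U}"
        proof
          fix y assume y: "y \<in> mball x r"
          then have "x \<in> M" "y \<in> M" "d x y < r" by auto
          then have "\<bar>d x (a n) - d y (a n)\<bar> < r"
            using triangle[of x y "a n"] triangle[of y x "a n"] \<open>a n \<in> M\<close> commute[of x y]
            by linarith
          then have "d y (a n) \<in> U" using r(2) by (auto simp: dist_real_def)
          then show "y \<in> {x \<in> topspace mtopology. d x (a n) \<in> U}" using y by auto
        qed
        then show "\<exists>r>0. mball x r \<subseteq> {x \<in> topspace mtopology. d x (a n) \<in> U}"
          using r by blast
      qed auto
    qed auto
  qed
  have cont: "continuous_map mtopology euclidean e"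
    unfolding e_def euclidean_product_topology[symmetric]
    by (rule continuous_map_coordinatewise_then_product) (use cont1 in auto)
  show "mtopology = pullback_topology M e euclidean"
    unfolding topology_eq openin_pullback_topology
  proof (intro allI iffI)
    fix U assume U: "openin mtopology U"
    define V where "V = \<Union>{W. open W \<and> e -` W \<inter> M \<subseteq> U}"
    have "U \<subseteq> e -` V \<inter> M"
    proof
      fix x assume x: "x \<in> U"
      then have xM: "x \<in> M" using U by (auto simp: openin_mtopology)
      obtain r where r: "r > 0" "mball x r \<subseteq> U" using U x by (auto simp: openin_mtopology)
      obtain n where n: "d x (a n) < r / 2" using near[OF xM, of "r / 2"] r by auto
      have "open {z :: nat \<Rightarrow> real. z n < r / 2}"
        by (intro open_Collect_less continuous_intros) simp
      moreover have "e -` {z. z n < r / 2} \<inter> M \<subseteq> U"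
      proof
        fix y assume y: "y \<in> e -` {z. z n < r / 2} \<inter> M"
        have "a n \<in> M" using a by auto
        then have "d x y < r"
          using y n triangle[of x "a n" y] xM commute[of y "a n"] by (auto simp: e_def)
        then show "y \<in> U" using r(2) y xM by auto
      qed
      ultimately have "{z. z n < r / 2} \<subseteq> V" unfolding V_def by blast
      then show "x \<in> e -` V \<inter> M" using n xM by (auto simp: e_def)
    qed
    moreover have "e -` V \<inter> M \<subseteq> U" unfolding V_def by auto
    moreover have "open V" unfolding V_def by auto
    ultimately show "\<exists>V. openin euclidean V \<and> U = e -` V \<inter> M" by (auto intro!: exI[of _ V])
  next
    fix U assume "\<exists>V. openin euclidean V \<and> U = e -` V \<inter> M"
    then show "openin mtopology U"
      using cont by (auto simp: continuous_map_alt)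
  qed
  show "inj_on e M"
  proof (rule inj_onI)
    fix x y assume xy: "x \<in> M" "y \<in> M" "e x = e y"
    show "x = y"
    proof (rule ccontr)
      assume "x \<noteq> y"
      then have "d x y > 0" using xy by auto
      then obtain n where n: "d x (a n) < d x y / 2" using near[OF xy(1), of "d x y / 2"] by auto
      have "d y (a n) = d x (a n)" using xy(3) by (auto simp: e_def fun_eq_iff)
      moreover have "a n \<in> M" using a by auto
      ultimately show False
        using n triangle[of x "a n" y] xy commute[of y "a n"] by auto
    qed
  qed
  let ?R = "(\<Inter>k. \<Inter>n. {z. \<bar>z n - d (a k) (a n)\<bar> \<le> z k}) \<inter> (\<Inter>j::nat. \<Union>k. {z. z k < inverse (Suc j)})"
  show "e ` M = ?R"
  proof (intro equalityI subsetI)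
    fix z assume "z \<in> e ` M"
    then obtain x where x: "x \<in> M" "z = e x" by auto
    have "\<bar>d x (a n) - d (a k) (a n)\<bar> \<le> d x (a k)" for n k
    proof -
      have "a n \<in> M" "a k \<in> M" using a by auto
      then show ?thesis
        using x(1) triangle[of x "a k" "a n"] triangle[of "a k" x "a n"] commute[of x "a k"]
        by linarith
    qed
    moreover have "\<exists>k. d x (a k) < inverse (Suc j)" for j :: nat
      using near[OF x(1)] by simp
    ultimately show "z \<in> ?R" using x by (auto simp: e_def)
  next
    fix z assume z: "z \<in> ?R"
    then have z1: "\<bar>z n - d (a k) (a n)\<bar> \<le> z k" for n k by auto
    have "\<forall>j::nat. \<exists>k. z k < inverse (Suc j)" using z by auto
    then obtain k where k: "\<And>j::nat. z (k j) < inverse (Suc j)" by metis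
    have lim: "(\<lambda>j. z (k j)) \<longlonglongrightarrow> 0"
    proof (rule tendsto_sandwich[OF _ _ tendsto_const LIMSEQ_inverse_real_of_nat])
      have "0 \<le> z (k n)" for n using z1[of 0 "k n"] by linarith
      then show "\<forall>\<^sub>F n in sequentially. 0 \<le> z (k n)" by simp
      show "\<forall>\<^sub>F n in sequentially. z (k n) \<le> inverse (real (Suc n))"
        using k by (intro always_eventually) (auto intro: less_imp_le)
    qed
    have "MCauchy (\<lambda>j. a (k j))"
      unfolding MCauchy_def
    proof (intro conjI allI impI)
      fix \<epsilon> :: real assume "\<epsilon> > 0"
      then have "\<forall>\<^sub>F j in sequentially. z (k j) < \<epsilon> / 2"
        using order_tendstoD(2)[OF lim, of "\<epsilon> / 2"] by simp
      then obtain N where N: "\<And>j. j \<ge> N \<Longrightarrow> z (k j) < \<epsilon> / 2"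
        by (auto simp: eventually_sequentially)
      have "d (a (k n)) (a (k n')) < \<epsilon>" if "N \<le> n" "N \<le> n'" for n n'
        using N[OF that(1)] N[OF that(2)] z1[of "k n'" "k n"] by linarith
      then show "\<exists>N. \<forall>n n'. N \<le> n \<longrightarrow> N \<le> n' \<longrightarrow> d (a (k n)) (a (k n')) < \<epsilon>" by blast
    qed (use a in auto)
    then obtain x where x: "limitin mtopology (\<lambda>j. a (k j)) x sequentially"
      using complete unfolding mcomplete_def by blast
    then have xM: "x \<in> M" and d0: "(\<lambda>j. d (a (k j)) x) \<longlonglongrightarrow> 0"
      by (auto simp: limitin_metric_dist_null)
    have "d x (a n) = z n" for n
    proof -
      have M: "a n \<in> M" "\<And>j. a j \<in> M" using a by auto
      have "\<bar>z n - d x (a n)\<bar> \<le> z (k j) + d (a (k j)) x" for j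
      proof -
        have "\<bar>d x (a n) - d (a (k j)) (a n)\<bar> \<le> d (a (k j)) x"
          using xM M(1) M(2)[of "k j"] triangle[of x "a (k j)" "a n"] triangle[of "a (k j)" x "a n"] commute[of x "a (k j)"]
          by linarith
        then show ?thesis using z1[of n "k j"] by linarith
      qed
      moreover have "(\<lambda>j. z (k j) + d (a (k j)) x) \<longlonglongrightarrow> 0 + 0"
        by (intro tendsto_add lim d0)
      ultimately have "\<bar>z n - d x (a n)\<bar> \<le> 0"
        by (intro LIMSEQ_le_const[of "\<lambda>j. z (k j) + d (a (k j)) x"]) auto
      then show ?thesis by simp
    qed
    then have "z = e x" by (auto simp: e_def)
    then show "z \<in> e ` M" using xM by auto
  qed
qed

text \<open>Makes theorems about the Polish type \<open>nat \<Rightarrow> real\<close> available for topologies with an explicit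
  carrier: measures are pushed forward along \<open>e\<close> and brought back along the Borel left
  inverse \<open>g\<close>, which exists because the image of \<open>e\<close> is a Borel set.\<close>
lemma polish_topology_borel_retract:
  fixes T :: "'a topology"
  assumes "polish_topology T" "topspace T \<noteq> {}"
  obtains e :: "'a \<Rightarrow> nat \<Rightarrow> real" and g
  where "T = pullback_topology (topspace T) e euclidean"
    and "g \<in> borel \<rightarrow>\<^sub>M borel_of T"
    and "\<And>x. x \<in> topspace T \<Longrightarrow> g (e x) = x"
proof -
  obtain M d where Md: "Metric_space M d" "Metric_space.mcomplete M d" "T = Metric_space.mtopology M d"
    using assms(1) unfolding polish_topology_def completely_metrizable_space_def by blast
  interpret Metric_space M d by fact
  have top: "topspace T = M" using Md by simp
  obtain S where S: "countable S" "S \<subseteq> topspace T" "T closure_of S = topspace T"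
    using assms(1) unfolding polish_topology_def separable_space_def by blast
  then have "S \<noteq> {}" using assms(2) by (metis closure_of_empty)
  define a where "a = from_nat_into S"
  have ra: "range a = S" using \<open>S \<noteq> {}\<close> S(1) by (simp add: a_def)
  define e where "e = (\<lambda>x n. d x (a n))"
  have e: "T = pullback_topology M e euclidean" "inj_on e M"
    "e ` M = (\<Inter>k. \<Inter>n. {z. \<bar>z n - d (a k) (a n)\<bar> \<le> z k}) \<inter> (\<Inter>j::nat. \<Union>k. {z. z k < inverse (Suc j)})"
    using distance_embedding[OF Md(2), of a] S ra top Md(3) by (auto simp: e_def)
  have "closed {z :: nat \<Rightarrow> real. \<bar>z n - d (a k) (a n)\<bar> \<le> z k}" for n k
    by (intro closed_Collect_le continuous_intros) simp_all
  moreover have "open {z :: nat \<Rightarrow> real. z k < inverse (Suc j)}" for k j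
    by (intro open_Collect_less continuous_intros) simp_all
  ultimately have "{z. \<bar>z n - d (a k) (a n)\<bar> \<le> z k} \<in> sets borel"
    "{z :: nat \<Rightarrow> real. z k < inverse (Suc j)} \<in> sets borel" for n k j
    by auto
  then have im: "e ` M \<in> sets borel"
    unfolding e(3) by (intro sets.Int sets.countable_INT sets.countable_UN) auto
  obtain x0 where x0: "x0 \<in> M" using assms(2) top by blast
  define g where "g z = (if z \<in> e ` M then the_inv_into M e z else x0)" for z
  have ge: "g (e x) = x" if "x \<in> M" for x
    using that e(2) by (simp add: g_def the_inv_into_f_f)
  have gM: "g z \<in> M" for z
    using x0 e(2) by (auto simp: g_def the_inv_into_f_f)
  have eg: "e (g z) = (if z \<in> e ` M then z else e x0)" for z
    using e(2) by (auto simp: g_def f_the_inv_into_f)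
  have "g \<in> borel \<rightarrow>\<^sub>M vimage_algebra M e borel"
  proof (rule measurable_vimage_algebra2)
    show "g \<in> space borel \<rightarrow> M" using gM by auto
    show "(\<lambda>x. e (g x)) \<in> borel_measurable borel"
      unfolding eg using im by measurable
  qed
  also have "borel \<rightarrow>\<^sub>M vimage_algebra M e borel = borel \<rightarrow>\<^sub>M borel_of T"
    using sets_borel_of_pullback[of T e] e(1) top by (intro measurable_cong_sets) auto
  finally have "g \<in> borel \<rightarrow>\<^sub>M borel_of T" .
  then show ?thesis using that e(1) top ge by auto
qed

lemma polish_imp_Hausdorff: "polish_topology T \<Longrightarrow> Hausdorff_space T"
  unfolding polish_topology_def
  using completely_metrizable_imp_metrizable_space metrizable_imp_Hausdorff_space by blast

lemma pullback_topology_Hausdorff_inj: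
  assumes "Hausdorff_space T" "T = pullback_topology (topspace T) e Z"
  shows "inj_on e (topspace T)"
proof (rule inj_onI, rule ccontr)
  fix x y assume xy: "x \<in> topspace T" "y \<in> topspace T" "e x = e y" "x \<noteq> y"
  then obtain U V where U: "openin T U" "x \<in> U" "openin T V" "y \<in> V" "disjnt U V"
    using assms(1) unfolding Hausdorff_space_def by blast
  have "openin (pullback_topology (topspace T) e Z) U" using U(1) assms(2) by metis
  then obtain W where "U = e -` W \<inter> topspace T"
    unfolding openin_pullback_topology by blast
  then have "y \<in> U" using U(2) xy by auto
  then show False using U by (auto simp: disjnt_iff)
qed

text \<open>Equality in \<open>T\<close> is equality of countably many real coordinates.\<close>
lemma pred_eq_polish:
  fixes T :: "'b topology"
  assumes T: "polish_topology T" and u: "u \<in> N \<rightarrow>\<^sub>M borel_of T" and v: "v \<in> N \<rightarrow>\<^sub>M borel_of T"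
  shows "Measurable.pred N (\<lambda>w. u w = v w)"
proof (cases "space N = {}")
  case True
  then show ?thesis by (simp add: pred_def)
next
  case False
  then have "topspace T \<noteq> {}" using measurable_space[OF u] by auto
  then obtain e :: "'b \<Rightarrow> nat \<Rightarrow> real" where e: "T = pullback_topology (topspace T) e euclidean"
    using polish_topology_borel_retract[OF T] by metis
  have em: "e \<in> borel_of T \<rightarrow>\<^sub>M borel"
    using measurable_vimage_algebra1[of e "topspace T" borel]
      measurable_cong_sets[OF sets_borel_of_pullback[OF e] refl, of borel] by auto
  have [measurable]: "(\<lambda>w. e (u w)) \<in> borel_measurable N" "(\<lambda>w. e (v w)) \<in> borel_measurable N"
    using measurable_compose[OF u em] measurable_compose[OF v em] by auto
  have "Measurable.pred N (\<lambda>w. \<forall>n. e (u w) n = e (v w) n)"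
  proof (intro pred_intros_countable)
    fix n
    have [measurable]: "(\<lambda>z :: nat \<Rightarrow> real. z n) \<in> borel_measurable borel"
      by (intro borel_measurable_continuous_onI) simp
    show "Measurable.pred N (\<lambda>w. e (u w) n = e (v w) n)"
      by measurable
  qed
  then show ?thesis
  proof (rule measurable_cong[THEN iffD1, rotated])
    fix w assume "w \<in> space N"
    then have "u w \<in> topspace T" "v w \<in> topspace T"
      using measurable_space[OF u] measurable_space[OF v] by auto
    then show "(\<forall>n. e (u w) n = e (v w) n) = (u w = v w)"
      using pullback_topology_Hausdorff_inj[OF polish_imp_Hausdorff[OF T] e]
      by (auto simp: inj_on_def)
  qed
qed

section \<open>Topology and Borel sets of the projective limit\<close>

context polish_projective_system
begin

abbreviation "L \<equiv> proj_lim_set D r X f"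
abbreviation "XD \<equiv> proj_lim D r X f"

lemma topspace_XD: "topspace XD = L"
  by (rule topspace_proj_lim[OF index_nonempty])

lemma index_rel:
  assumes "(I, J) \<in> r" shows "I \<in> D" "J \<in> D"
  using assms partial_order by (auto simp: partial_order_on_def preorder_on_def)

lemma countable_rel: "countable r"
  using countable_index partial_order unfolding partial_order_on_def preorder_on_def
  by (meson countable_SIGMA countable_subset)

lemma rel_refl: "I \<in> D \<Longrightarrow> (I, I) \<in> r"
  using partial_order by (auto simp: partial_order_on_def preorder_on_def refl_on_def)

lemma rel_trans: "(I, J) \<in> r \<Longrightarrow> (J, K) \<in> r \<Longrightarrow> (I, K) \<in> r"
  using partial_order by (auto simp: partial_order_on_def preorder_on_def trans_def)

lemma f_measurable: "(I, J) \<in> r \<Longrightarrow> f J I \<in> borel_of (X J) \<rightarrow>\<^sub>M borel_of (X I)"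
  by (intro continuous_map_borel_of_measurable continuous)

lemma f_topspace: "(I, J) \<in> r \<Longrightarrow> x \<in> topspace (X J) \<Longrightarrow> f J I x \<in> topspace (X I)"
  using continuous by (fastforce simp: continuous_map_def)

lemma coord_topspace: "x \<in> L \<Longrightarrow> I \<in> D \<Longrightarrow> x I \<in> topspace (X I)"
  by (auto simp: proj_lim_set_def PiE_def)

lemma coord_rel: "x \<in> L \<Longrightarrow> (I, J) \<in> r \<Longrightarrow> f J I (x J) = x I"
  by (auto simp: proj_lim_set_def)

lemma L_eqI:
  assumes "x \<in> L" "y \<in> L" "\<And>I. I \<in> D \<Longrightarrow> x I = y I" shows "x = y"
proof -
  have "x \<in> (\<Pi>\<^sub>E I\<in>D. topspace (X I))" "y \<in> (\<Pi>\<^sub>E I\<in>D. topspace (X I))"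
    using assms by (auto simp: proj_lim_set_def)
  then show ?thesis using assms(3) by (rule PiE_ext)
qed

lemma finite_upper_bound:
  assumes "finite F" "F \<subseteq> D"
  shows "\<exists>K\<in>D. \<forall>I\<in>F. (I, K) \<in> r"
  using assms
proof (induction F rule: finite_induct)
  case empty
  then show ?case using index_nonempty by auto
next
  case (insert J F)
  then obtain K where K: "K \<in> D" "\<forall>I\<in>F. (I, K) \<in> r" by auto
  obtain H where "H \<in> D" "(J, H) \<in> r" "(K, H) \<in> r"
    using directed[of J K] insert.prems K(1) by auto
  then show ?case using K(2) rel_trans by blast
qed

text \<open>Turns directed limits over \<open>D\<close> into limits of sequences, for which measures are continuous.\<close>
lemma cofinal_chain:
  obtains c :: "nat \<Rightarrow> 'i" where "\<And>n. c n \<in> D" "\<And>n. (c n, c (Suc n)) \<in> r"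
    "\<And>I. I \<in> D \<Longrightarrow> \<exists>n. (I, c n) \<in> r"
proof -
  let ?d = "from_nat_into D"
  have dD: "?d n \<in> D" for n using index_nonempty by (rule from_nat_into)
  have "\<exists>c. \<forall>n. (c n \<in> D \<and> (?d n, c n) \<in> r) \<and> (c n, c (Suc n)) \<in> r"
  proof (rule dependent_nat_choice)
    show "\<exists>x. x \<in> D \<and> (?d 0, x) \<in> r" using dD rel_refl by blast
  next
    fix x n assume "x \<in> D \<and> (?d n, x) \<in> r"
    then show "\<exists>y. (y \<in> D \<and> (?d (Suc n), y) \<in> r) \<and> (x, y) \<in> r"
      using directed[of x "?d (Suc n)"] dD by blast
  qed
  then obtain c where c: "\<And>n. c n \<in> D" "\<And>n. (?d n, c n) \<in> r" "\<And>n. (c n, c (Suc n)) \<in> r"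
    by blast
  have "\<exists>n. (I, c n) \<in> r" if "I \<in> D" for I
    using c(2)[of "to_nat_on D I"] that countable_index by auto
  then show ?thesis using that c by blast
qed

text \<open>The defining subbasis of the limit topology is a basis: two sets \<open>{x. x I \<in> V}\<close> and
  \<open>{x. x J \<in> W}\<close> are both conditions on the coordinate at a common upper bound of \<open>I\<close> and \<open>J\<close>.\<close>
lemma openin_XD_iff:
  "openin XD U \<longleftrightarrow> U \<subseteq> L \<and>
     (\<forall>x\<in>U. \<exists>I\<in>D. \<exists>V. openin (X I) V \<and> x I \<in> V \<and> {y \<in> L. y I \<in> V} \<subseteq> U)"
  (is "_ \<longleftrightarrow> ?R U")
proof
  assume "openin XD U"
  then have "generate_topology_on {{x \<in> L. x I \<in> V} | I V. I \<in> D \<and> openin (X I) V} U"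
    unfolding proj_lim_def by (rule openin_topology_generated_by)
  then show "?R U"
  proof induction
    case (Int a b)
    show ?case
    proof (intro conjI ballI)
      fix x assume x: "x \<in> a \<inter> b"
      then have xL: "x \<in> L" using Int by auto
      obtain I V where V: "I \<in> D" "openin (X I) V" "x I \<in> V" "{y \<in> L. y I \<in> V} \<subseteq> a"
        using Int x by blast
      obtain J W where W: "J \<in> D" "openin (X J) W" "x J \<in> W" "{y \<in> L. y J \<in> W} \<subseteq> b"
        using Int x by blast
      obtain K where K: "K \<in> D" "(I, K) \<in> r" "(J, K) \<in> r" using directed V W by blast
      let ?V = "(f K I -` V \<inter> topspace (X K)) \<inter> (f K J -` W \<inter> topspace (X K))"
      have "openin (X K) ?V"
        using continuous[OF K(2)] continuous[OF K(3)] V W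
        by (intro openin_Int[of _ "f K I -` V \<inter> topspace (X K)"]) (simp_all only: continuous_map_alt)
      moreover have "x K \<in> ?V"
        using coord_rel[OF xL K(2)] coord_rel[OF xL K(3)] coord_topspace[OF xL K(1)] V W by auto
      moreover have "{y \<in> L. y K \<in> ?V} \<subseteq> a \<inter> b"
        using V(4) W(4) coord_rel K by auto
      ultimately show "\<exists>I\<in>D. \<exists>V. openin (X I) V \<and> x I \<in> V \<and> {y \<in> L. y I \<in> V} \<subseteq> a \<inter> b"
        using K(1) by blast
    qed (use Int in auto)
  next
    case (UN A)
    show ?case
    proof (intro conjI ballI)
      show "\<Union>A \<subseteq> L" using UN(2) by (meson Sup_least)
      fix x assume "x \<in> \<Union>A"
      then obtain a where a: "a \<in> A" "x \<in> a" by blast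
      then obtain I V where "I \<in> D" "openin (X I) V" "x I \<in> V" "{y \<in> L. y I \<in> V} \<subseteq> a"
        using UN(2)[OF a(1)] by meson
      moreover have "a \<subseteq> \<Union>A" using a by blast
      ultimately show "\<exists>I\<in>D. \<exists>V. openin (X I) V \<and> x I \<in> V \<and> {y \<in> L. y I \<in> V} \<subseteq> \<Union>A"
        by (meson order_trans)
    qed
  next
    case (Basis s)
    then obtain I V where s: "s = {x \<in> L. x I \<in> V}" and IV: "I \<in> D" "openin (X I) V" by blast
    show ?case
    proof (intro conjI ballI)
      show "s \<subseteq> L" using s by blast
      fix x assume "x \<in> s"
      then have "x I \<in> V" using s by blast
      then show "\<exists>I\<in>D. \<exists>V. openin (X I) V \<and> x I \<in> V \<and> {y \<in> L. y I \<in> V} \<subseteq> s"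
        using IV s by blast
    qed
  qed auto
next
  assume R: "?R U"
  show "openin XD U"
  proof (subst openin_subopen, intro ballI)
    fix x assume x: "x \<in> U"
    then obtain I V where IV: "I \<in> D" "openin (X I) V" "x I \<in> V" "{y \<in> L. y I \<in> V} \<subseteq> U"
      using R by blast
    have "openin XD {y \<in> L. y I \<in> V}"
      unfolding proj_lim_def using IV by (intro topology_generated_by_Basis) blast
    then show "\<exists>T. openin XD T \<and> x \<in> T \<and> T \<subseteq> U"
      using IV x R by blast
  qed
qed

lemma continuous_coord: "I \<in> D \<Longrightarrow> continuous_map XD (X I) (\<lambda>x. x I)"
  unfolding continuous_map_def topspace_XD
  by (auto simp: coord_topspace openin_XD_iff)

lemma coord_measurable: "I \<in> D \<Longrightarrow> (\<lambda>x. x I) \<in> borel_of XD \<rightarrow>\<^sub>M borel_of (X I)"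
  by (intro continuous_map_borel_of_measurable continuous_coord)

lemma Hausdorff_XD: "Hausdorff_space XD"
  unfolding Hausdorff_space_def topspace_XD
proof (intro allI impI)
  fix x y assume xy: "x \<in> L \<and> y \<in> L \<and> x \<noteq> y"
  then obtain I where I: "I \<in> D" "x I \<noteq> y I" using L_eqI by blast
  have "Hausdorff_space (X I)" using polish polish_imp_Hausdorff I by blast
  then obtain U V where UV: "openin (X I) U" "openin (X I) V" "x I \<in> U" "y I \<in> V" "disjnt U V"
    using I xy coord_topspace unfolding Hausdorff_space_def by meson
  have "openin XD {z \<in> topspace XD. z I \<in> U}" "openin XD {z \<in> topspace XD. z I \<in> V}"
    using continuous_coord[OF I(1)] UV by (auto simp: continuous_map_def)
  then show "\<exists>U V. openin XD U \<and> openin XD V \<and> x \<in> U \<and> y \<in> V \<and> disjnt U V"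
    using UV xy by (intro exI[of _ "{z \<in> topspace XD. z I \<in> U}"] exI[of _ "{z \<in> topspace XD. z I \<in> V}"])
      (auto simp: topspace_XD disjnt_iff)
qed

text \<open>Embeddings of the countably many spaces \<open>X I\<close> into one type combine to an embedding of the limit
  into the sequences over this type.\<close>
lemma XD_pullback:
  fixes e :: "'i \<Rightarrow> 'x \<Rightarrow> 'b::topological_space"
  assumes e: "\<And>I. I \<in> D \<Longrightarrow> X I = pullback_topology (topspace (X I)) (e I) euclidean"
  defines "E \<equiv> \<lambda>x n. e (from_nat_into D n) (x (from_nat_into D n))"
  shows "XD = pullback_topology (topspace XD) E euclidean"
  unfolding topology_eq openin_pullback_topology
proof (intro allI iffI)
  have dD: "from_nat_into D n \<in> D" for n using index_nonempty by (rule from_nat_into)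
  have oe: "openin (X I) V \<longleftrightarrow> (\<exists>W. open W \<and> V = e I -` W \<inter> topspace (X I))" if "I \<in> D" for I V
    using openin_pullback_topology[of "topspace (X I)" "e I" euclidean V] e[OF that] by simp
  {
    fix U assume U: "openin XD U"
    define V where "V = \<Union>{W. open W \<and> E -` W \<inter> L \<subseteq> U}"
    have "x \<in> E -` V" if x: "x \<in> U" for x
    proof -
      obtain I W where W: "I \<in> D" "openin (X I) W" "x I \<in> W" "{y \<in> L. y I \<in> W} \<subseteq> U"
        using U x unfolding openin_XD_iff by blast
      then obtain W' where W': "open W'" "W = e I -` W' \<inter> topspace (X I)" using oe by blast
      define n where "n = to_nat_on D I"
      have n: "from_nat_into D n = I" using W(1) countable_index by (simp add: n_def)
      have "open ((\<lambda>z :: nat \<Rightarrow> 'b. z n) -` W')"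
        using W'(1) by (intro open_vimage continuous_on_product_coordinates)
      moreover have "E -` ((\<lambda>z. z n) -` W') \<inter> L \<subseteq> U"
        using W(4) W'(2) coord_topspace[OF _ W(1)] by (auto simp: E_def n)
      ultimately have "(\<lambda>z. z n) -` W' \<subseteq> V" unfolding V_def by blast
      then show ?thesis using W(3) W'(2) by (auto simp: E_def n)
    qed
    moreover have "U \<subseteq> L" using U openin_XD_iff by auto
    moreover have "open V" unfolding V_def by auto
    ultimately show "\<exists>V. openin euclidean V \<and> U = E -` V \<inter> topspace XD"
      by (intro exI[of _ V]) (auto simp: topspace_XD V_def)
  next
    fix U assume "\<exists>V. openin euclidean V \<and> U = E -` V \<inter> topspace XD"
    then obtain V where V: "open V" "U = E -` V \<inter> topspace XD" by auto
    have "continuous_map XD euclidean E"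
      unfolding euclidean_product_topology[symmetric]
    proof (rule continuous_map_coordinatewise_then_product)
      fix n
      have "continuous_map (X (from_nat_into D n)) euclidean (e (from_nat_into D n))"
        unfolding continuous_map_alt using oe[OF dD] by auto
      from continuous_map_compose[OF continuous_coord[OF dD] this]
      show "continuous_map XD euclidean (\<lambda>x. E x n)" by (simp add: E_def comp_def)
    qed auto
    then show "openin XD U" using V by (simp add: continuous_map_alt)
  }
qed

lemma coordinate_embeddings:
  assumes "L \<noteq> {}"
  obtains e :: "'i \<Rightarrow> 'x \<Rightarrow> nat \<Rightarrow> real"
  where "\<And>I. I \<in> D \<Longrightarrow> X I = pullback_topology (topspace (X I)) (e I) euclidean"
proof -
  have "\<exists>e :: 'x \<Rightarrow> nat \<Rightarrow> real. X I = pullback_topology (topspace (X I)) e euclidean" if "I \<in> D" for I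
  proof -
    have "topspace (X I) \<noteq> {}" using assms coord_topspace[OF _ that] by auto
    from polish_topology_borel_retract[OF polish[OF that] this] show ?thesis by metis
  qed
  then show ?thesis using that by metis
qed

text \<open>The Borel sets of the limit are generated by the coordinates. Countability of \<open>D\<close> enters here:
  for a countable product of second countable spaces, the Borel \<open>\<sigma>\<close>-algebra of the product
  topology is the product of the Borel \<open>\<sigma>\<close>-algebras.\<close>
lemma measurable_into_XD:
  assumes h: "h \<in> space N \<rightarrow> L"
    and coord: "\<And>I. I \<in> D \<Longrightarrow> (\<lambda>w. h w I) \<in> N \<rightarrow>\<^sub>M borel_of (X I)"
  shows "h \<in> N \<rightarrow>\<^sub>M borel_of XD"
proof (cases "space N = {}")
  case True
  then show ?thesis by (simp add: measurable_def topspace_XD)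
next
  case False
  then have "L \<noteq> {}" using h by auto
  then obtain e :: "'i \<Rightarrow> 'x \<Rightarrow> nat \<Rightarrow> real"
    where e: "\<And>I. I \<in> D \<Longrightarrow> X I = pullback_topology (topspace (X I)) (e I) euclidean"
    using coordinate_embeddings by metis
  let ?d = "from_nat_into D"
  define E where "E = (\<lambda>x n. e (?d n) (x (?d n)))"
  have E: "XD = pullback_topology (topspace XD) E euclidean"
    unfolding E_def by (rule XD_pullback[OF e])
  have "h \<in> N \<rightarrow>\<^sub>M vimage_algebra (topspace XD) E borel"
  proof (rule measurable_vimage_algebra2)
    show "h \<in> space N \<rightarrow> topspace XD" using h by (simp add: topspace_XD)
    show "(\<lambda>w. E (h w)) \<in> borel_measurable N"
    proof (rule measurable_coordinatewise_then_product)
      fix n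
      have d: "?d n \<in> D" using index_nonempty by (rule from_nat_into)
      have "e (?d n) \<in> borel_of (X (?d n)) \<rightarrow>\<^sub>M borel"
        using measurable_vimage_algebra1[of "e (?d n)" "topspace (X (?d n))" borel]
          measurable_cong_sets[OF sets_borel_of_pullback[OF e[OF d]] refl, of borel] by auto
      from measurable_compose[OF coord[OF d] this]
      show "(\<lambda>w. E (h w) n) \<in> borel_measurable N" by (simp add: E_def)
    qed
  qed
  then show ?thesis
    using measurable_cong_sets[OF refl sets_borel_of_pullback[OF E]] by blast
qed

definition cylinders :: "('i \<Rightarrow> 'x) set set" where
  "cylinders = {{x \<in> L. x I \<in> A} | I A. I \<in> D \<and> A \<in> sets (borel_of (X I))}"

lemma cylinders_subset: "cylinders \<subseteq> Pow L"
  by (auto simp: cylinders_def)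

lemma L_in_cylinders: "L \<in> cylinders"
proof -
  obtain I where I: "I \<in> D" using index_nonempty by auto
  then have "L = {x \<in> L. x I \<in> space (borel_of (X I))}" using coord_topspace by auto
  then show ?thesis unfolding cylinders_def using I sets.top by blast
qed

lemma Int_stable_cylinders: "Int_stable cylinders"
proof (rule Int_stableI)
  fix a b assume "a \<in> cylinders" "b \<in> cylinders"
  then obtain I A J B where a: "I \<in> D" "A \<in> sets (borel_of (X I))" "a = {x \<in> L. x I \<in> A}"
    and b: "J \<in> D" "B \<in> sets (borel_of (X J))" "b = {x \<in> L. x J \<in> B}"
    unfolding cylinders_def by blast
  obtain K where K: "K \<in> D" "(I, K) \<in> r" "(J, K) \<in> r" using directed a b by blast
  let ?C = "(f K I -` A \<inter> space (borel_of (X K))) \<inter> (f K J -` B \<inter> space (borel_of (X K)))"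
  have "?C \<in> sets (borel_of (X K))"
    using measurable_sets[OF f_measurable[OF K(2)] a(2)] measurable_sets[OF f_measurable[OF K(3)] b(2)]
    by blast
  moreover have "a \<inter> b = {x \<in> L. x K \<in> ?C}"
    using coord_rel K coord_topspace[OF _ K(1)] by (auto simp: a b)
  ultimately show "a \<inter> b \<in> cylinders" using K(1) unfolding cylinders_def by blast
qed

lemma cylinder_sets: "I \<in> D \<Longrightarrow> A \<in> sets (borel_of (X I)) \<Longrightarrow> {x \<in> L. x I \<in> A} \<in> sets (borel_of XD)"
  using measurable_sets[OF coord_measurable, of I A] by (simp add: vimage_def Int_def topspace_XD conj_commute)

lemma sets_XD: "sets (borel_of XD) = sigma_sets L cylinders"
proof
  have "(\<lambda>x. x) \<in> sigma L cylinders \<rightarrow>\<^sub>M borel_of XD"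
  proof (rule measurable_into_XD)
    show "(\<lambda>x. x) \<in> space (sigma L cylinders) \<rightarrow> L"
      using cylinders_subset by (simp add: space_measure_of_conv)
    fix I assume I: "I \<in> D"
    show "(\<lambda>w. w I) \<in> sigma L cylinders \<rightarrow>\<^sub>M borel_of (X I)"
    proof (rule measurableI)
      show "x I \<in> space (borel_of (X I))" if "x \<in> space (sigma L cylinders)" for x
        using that coord_topspace[OF _ I] by (simp add: space_measure_of_conv)
      fix A assume "A \<in> sets (borel_of (X I))"
      then have "{x \<in> L. x I \<in> A} \<in> cylinders" using I unfolding cylinders_def by blast
      moreover have "(\<lambda>w. w I) -` A \<inter> space (sigma L cylinders) = {x \<in> L. x I \<in> A}"
        by (auto simp: space_measure_of_conv)
      ultimately show "(\<lambda>w. w I) -` A \<inter> space (sigma L cylinders) \<in> sets (sigma L cylinders)"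
        by (simp add: sets_measure_of[OF cylinders_subset])
    qed
  qed
  from measurable_sets[OF this]
  have "A \<inter> L \<in> sigma_sets L cylinders" if "A \<in> sets (borel_of XD)" for A
    using that by (simp add: sets_measure_of[OF cylinders_subset] space_measure_of_conv)
  moreover have "A \<inter> L = A" if "A \<in> sets (borel_of XD)" for A
    using sets.sets_into_space[OF that] by (auto simp: topspace_XD)
  ultimately show "sets (borel_of XD) \<subseteq> sigma_sets L cylinders" by (metis subsetI)
  have "sigma_sets (space (borel_of XD)) cylinders \<subseteq> sets (borel_of XD)"
    by (rule sets.sigma_sets_subset) (auto simp: cylinders_def intro: cylinder_sets)
  then show "sigma_sets L cylinders \<subseteq> sets (borel_of XD)" by (simp add: topspace_XD)
qed

lemma marginal_emeasure:
  assumes "I \<in> D" "A \<in> sets (borel_of (X I))" "sets \<mu> = sets (borel_of XD)"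
  shows "emeasure (distr \<mu> (borel_of (X I)) (\<lambda>x. x I)) A = emeasure \<mu> {x \<in> L. x I \<in> A}"
proof -
  have "(\<lambda>x. x I) \<in> \<mu> \<rightarrow>\<^sub>M borel_of (X I)"
    using coord_measurable[OF assms(1)] measurable_cong_sets[OF assms(3) refl] by blast
  moreover have "(\<lambda>x. x I) -` A \<inter> space \<mu> = {x \<in> L. x I \<in> A}"
    using sets_eq_imp_space_eq[OF assms(3)] by (auto simp: topspace_XD)
  ultimately show ?thesis using assms(2) by (simp add: emeasure_distr)
qed

text \<open>A probability measure on the limit is determined by its marginals, since they fix its values on the
  intersection-stable generator of cylinders.\<close>
lemma measure_on_XD_eqI:
  assumes "prob_space \<mu>" "sets \<mu> = sets (borel_of XD)" "sets \<nu> = sets (borel_of XD)"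
    and "\<And>I. I \<in> D \<Longrightarrow> distr \<mu> (borel_of (X I)) (\<lambda>x. x I) = distr \<nu> (borel_of (X I)) (\<lambda>x. x I)"
  shows "\<mu> = \<nu>"
proof (rule measure_eqI_generator_eq[OF Int_stable_cylinders cylinders_subset])
  interpret prob_space \<mu> by fact
  show "emeasure \<mu> Y = emeasure \<nu> Y" if cyl: "Y \<in> cylinders" for Y
  proof -
    obtain I A where I: "I \<in> D" and A: "A \<in> sets (borel_of (X I))" and Y: "Y = {x \<in> L. x I \<in> A}"
      using cyl unfolding cylinders_def by blast
    show ?thesis
      using marginal_emeasure[OF I A assms(2)] marginal_emeasure[OF I A assms(3)] assms(4)[OF I]
      by (simp add: Y)
  qed
  show "range (\<lambda>_. L) \<subseteq> cylinders" "(\<Union>i::nat. L) = L" using L_in_cylinders by auto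
  show "emeasure \<mu> L \<noteq> \<infinity>" by simp
qed (use assms sets_XD in auto)

section \<open>Existence of the limit measure\<close>

text \<open>Kolmogorov's extension theorem for the projective system. The embeddings \<open>e I\<close> move all
  coordinates into the type \<open>nat \<Rightarrow> real\<close>. For a finite set \<open>F\<close> of indices, the joint
  distribution of the coordinates in \<open>F\<close> is the image of \<open>\<mu> K\<close> for any upper bound \<open>K\<close> of \<open>F\<close>, and
  consistency makes it independent of \<open>K\<close>. The resulting measure on the full product is
  concentrated on the points that satisfy the countably many relations \<open>x I = f J I (x J)\<close>,
  because each of them holds almost surely in the joint distribution of two coordinates.\<close>
theorem limit_measure_exists:
  assumes prob: "\<And>I. I \<in> D \<Longrightarrow> prob_space (\<mu> I)"
    and sets_mu: "\<And>I. I \<in> D \<Longrightarrow> sets (\<mu> I) = sets (borel_of (X I))"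
    and proj: "\<And>I J. (I, J) \<in> r \<Longrightarrow> distr (\<mu> J) (borel_of (X I)) (f J I) = \<mu> I"
  obtains \<nu> where "prob_space \<nu>" "sets \<nu> = sets (borel_of XD)"
    "\<And>I. I \<in> D \<Longrightarrow> distr \<nu> (borel_of (X I)) (\<lambda>x. x I) = \<mu> I"
proof -
  have space_mu: "space (\<mu> I) = topspace (X I)" if "I \<in> D" for I
    using sets_eq_imp_space_eq[OF sets_mu[OF that]] by simp
  have nonempty: "topspace (X I) \<noteq> {}" if "I \<in> D" for I
    using prob_space.not_empty[OF prob[OF that]] space_mu[OF that] by simp
  have "\<exists>(e :: 'x \<Rightarrow> nat \<Rightarrow> real) g. e \<in> borel_of (X I) \<rightarrow>\<^sub>M borel \<and> g \<in> borel \<rightarrow>\<^sub>M borel_of (X I) \<and>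
      (\<forall>x\<in>topspace (X I). g (e x) = x)" if I: "I \<in> D" for I
  proof -
    obtain e :: "'x \<Rightarrow> nat \<Rightarrow> real" and g where e: "X I = pullback_topology (topspace (X I)) e euclidean"
      and g: "g \<in> borel \<rightarrow>\<^sub>M borel_of (X I)" "\<And>x. x \<in> topspace (X I) \<Longrightarrow> g (e x) = x"
      using polish_topology_borel_retract[OF polish[OF I] nonempty[OF I]] by metis
    have "e \<in> borel_of (X I) \<rightarrow>\<^sub>M borel"
      using measurable_vimage_algebra1[of e "topspace (X I)" borel]
        measurable_cong_sets[OF sets_borel_of_pullback[OF e] refl, of borel] by auto
    then show ?thesis using g by blast
  qed
  then obtain e :: "'i \<Rightarrow> 'x \<Rightarrow> nat \<Rightarrow> real" and g where
    e: "\<And>I. I \<in> D \<Longrightarrow> e I \<in> borel_of (X I) \<rightarrow>\<^sub>M borel" and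
    g: "\<And>I. I \<in> D \<Longrightarrow> g I \<in> borel \<rightarrow>\<^sub>M borel_of (X I)" and
    ge: "\<And>I x. I \<in> D \<Longrightarrow> x \<in> topspace (X I) \<Longrightarrow> g I (e I x) = x"
    by metis
  \<comment> \<open>All coordinates in \<open>F\<close> as functions of the one at an upper bound \<open>K\<close>.\<close>
  define q where "q F K = (\<lambda>x. \<lambda>I\<in>F. e I (f K I x))" for F K
  have q_meas: "q F K \<in> borel_of (X K) \<rightarrow>\<^sub>M PiM F (\<lambda>_. borel)" if "\<forall>I\<in>F. (I, K) \<in> r" for F K
    unfolding q_def
  proof (rule measurable_restrict)
    fix I assume "I \<in> F"
    then have "(I, K) \<in> r" using that by blast
    then show "(\<lambda>x. e I (f K I x)) \<in> borel_of (X K) \<rightarrow>\<^sub>M borel"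
      using measurable_compose[OF f_measurable e] index_rel by blast
  qed
  \<comment> \<open>Passing from an upper bound to a larger one does not change the joint distribution; any two
      upper bounds have a common larger one.\<close>
  have step: "distr (\<mu> H) (PiM F (\<lambda>_. borel)) (q F H) = distr (\<mu> K) (PiM F (\<lambda>_. borel)) (q F K)"
    if F: "\<forall>I\<in>F. (I, K) \<in> r" and KH: "(K, H) \<in> r" for F K H
  proof -
    have H: "H \<in> D" and K: "K \<in> D" using index_rel KH by auto
    have "distr (\<mu> K) (PiM F (\<lambda>_. borel)) (q F K)
        = distr (distr (\<mu> H) (borel_of (X K)) (f H K)) (PiM F (\<lambda>_. borel)) (q F K)"
      using proj[OF KH] by simp
    also have "\<dots> = distr (\<mu> H) (PiM F (\<lambda>_. borel)) (q F K \<circ> f H K)"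
      using q_meas[OF F] f_measurable[OF KH] sets_mu[OF H]
      by (intro distr_distr) (auto simp: measurable_cong_sets[OF sets_mu[OF H] refl])
    also have "\<dots> = distr (\<mu> H) (PiM F (\<lambda>_. borel)) (q F H)"
    proof (rule distr_cong)
      fix x assume "x \<in> space (\<mu> H)"
      then have x: "x \<in> topspace (X H)" using space_mu H by simp
      show "(q F K \<circ> f H K) x = q F H x"
        using f_comp[OF _ KH x] F by (auto simp: q_def fun_eq_iff restrict_def)
    qed auto
    finally show ?thesis by simp
  qed
  have indep: "distr (\<mu> H) (PiM F (\<lambda>_. borel)) (q F H) = distr (\<mu> K) (PiM F (\<lambda>_. borel)) (q F K)"
    if "\<forall>I\<in>F. (I, K) \<in> r" "\<forall>I\<in>F. (I, H) \<in> r" "K \<in> D" "H \<in> D" for F K H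
  proof -
    from directed[OF that(3,4)] obtain U where U: "(K, U) \<in> r" "(H, U) \<in> r" by blast
    show ?thesis using step[OF that(1) U(1)] step[OF that(2) U(2)] by simp
  qed
  define ub where "ub F = (SOME K. K \<in> D \<and> (\<forall>I\<in>F. (I, K) \<in> r))" for F
  have ub: "ub F \<in> D" "\<And>I. I \<in> F \<Longrightarrow> (I, ub F) \<in> r" if "finite F" "F \<subseteq> D" for F
    using someI_ex[OF finite_upper_bound[OF that, unfolded Bex_def]] unfolding ub_def by auto
  define Q where "Q F = distr (\<mu> (ub F)) (PiM F (\<lambda>_. borel)) (q F (ub F))" for F
  have Q_eq: "Q F = distr (\<mu> K) (PiM F (\<lambda>_. borel)) (q F K)"
    if "finite F" "F \<subseteq> D" "K \<in> D" "\<forall>I\<in>F. (I, K) \<in> r" for F K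
    unfolding Q_def using that ub by (intro indep) auto
  have q_mu: "q F K \<in> \<mu> K \<rightarrow>\<^sub>M PiM F (\<lambda>_. borel)" if "\<forall>I\<in>F. (I, K) \<in> r" "K \<in> D" for F K
    using q_meas[OF that(1)] measurable_cong_sets[OF sets_mu[OF that(2)] refl] by blast
  interpret Q: polish_projective D Q
    unfolding polish_projective_def
  proof (rule projective_family.intro)
    fix J H assume JH: "J \<subseteq> H" "finite H" "H \<subseteq> D"
    have ubH: "\<forall>I\<in>H. (I, ub H) \<in> r" "ub H \<in> D" using ub JH by auto
    have "distr (Q H) (PiM J (\<lambda>_. borel)) (\<lambda>f. restrict f J)
        = distr (\<mu> (ub H)) (PiM J (\<lambda>_. borel)) ((\<lambda>f. restrict f J) \<circ> q H (ub H))"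
      unfolding Q_def
      by (intro distr_distr measurable_restrict_subset JH q_mu ubH)
    also have "(\<lambda>f. restrict f J) \<circ> q H (ub H) = q J (ub H)"
      using JH(1) by (auto simp: q_def fun_eq_iff restrict_def)
    also have "distr (\<mu> (ub H)) (PiM J (\<lambda>_. borel)) (q J (ub H)) = Q J"
      using JH ubH by (intro Q_eq[symmetric]) (auto intro: finite_subset)
    finally show "Q J = distr (Q H) (PiM J (\<lambda>_. borel)) (\<lambda>f. restrict f J)" by (rule sym)
  next
    fix J assume J: "finite J" "J \<subseteq> D"
    show "prob_space (Q J)"
      unfolding Q_def using ub[OF J] by (intro prob_space.prob_space_distr prob q_mu) auto
  qed
  define \<Lambda> where "\<Lambda> = Q.lim"
  have sets_L: "sets \<Lambda> = sets (PiM D (\<lambda>_. borel))" and prob_L: "prob_space \<Lambda>"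
    by (simp_all add: \<Lambda>_def Q.P.prob_space_axioms)
  interpret \<Lambda>: prob_space \<Lambda> by fact
  have space_L: "space \<Lambda> = (\<Pi>\<^sub>E i\<in>D. UNIV)"
    using sets_eq_imp_space_eq[OF sets_L] by (simp add: space_PiM)
  have restr_L: "(\<lambda>z. restrict z F) \<in> \<Lambda> \<rightarrow>\<^sub>M PiM F (\<lambda>_. borel)" if "F \<subseteq> D" for F
    using measurable_restrict_subset[OF that, of "\<lambda>_. borel"] measurable_cong_sets[OF sets_L refl] by blast
  have marg: "distr \<Lambda> (PiM F (\<lambda>_. borel)) (\<lambda>z. restrict z F) = Q F" if F: "finite F" "F \<subseteq> D" for F
  proof (rule measure_eqI)
    show "sets (distr \<Lambda> (PiM F (\<lambda>_. borel)) (\<lambda>z. restrict z F)) = sets (Q F)"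
      by (simp add: Q_def)
    fix A assume "A \<in> sets (distr \<Lambda> (PiM F (\<lambda>_. borel)) (\<lambda>z. restrict z F))"
    then have A: "A \<in> sets (PiM F (\<lambda>_. borel))" by simp
    have "(\<lambda>z. restrict z F) -` A \<inter> space \<Lambda> = prod_emb D (\<lambda>_. borel) F A"
      by (simp add: prod_emb_def space_L)
    then have "emeasure (distr \<Lambda> (PiM F (\<lambda>_. borel)) (\<lambda>z. restrict z F)) A
        = emeasure \<Lambda> (prod_emb D (\<lambda>_. borel) F A)"
      by (simp only: emeasure_distr[OF restr_L[OF F(2)] A])
    then show "emeasure (distr \<Lambda> (PiM F (\<lambda>_. borel)) (\<lambda>z. restrict z F)) A = emeasure (Q F) A"
      using Q.emeasure_lim_emb[OF F(2,1) A] by (simp only: \<Lambda>_def)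
  qed
  have comp: "(\<lambda>z. z I) \<in> \<Lambda> \<rightarrow>\<^sub>M borel" if "I \<in> D" for I
    using measurable_component_singleton[OF that, of "\<lambda>_. borel"] measurable_cong_sets[OF sets_L refl] by blast
  have gc: "(\<lambda>z. g I (z I)) \<in> \<Lambda> \<rightarrow>\<^sub>M borel_of (X I)" if "I \<in> D" for I
    using measurable_compose[OF comp g] that by blast
  define cons where "cons z \<longleftrightarrow> (\<forall>p\<in>r. g (fst p) (z (fst p)) = f (snd p) (fst p) (g (snd p) (z (snd p))))" for z
  have cons_meas: "Measurable.pred \<Lambda> cons"
    unfolding cons_def pred_def
  proof (rule sets.sets_Collect_countable_All'[OF _ countable_rel])
    fix p assume "p \<in> r"
    then have p: "(fst p, snd p) \<in> r" by simp
    show "{z \<in> space \<Lambda>. g (fst p) (z (fst p)) = f (snd p) (fst p) (g (snd p) (z (snd p)))} \<in> sets \<Lambda>"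
      unfolding pred_def[symmetric]
      by (rule pred_eq_polish[OF polish[OF index_rel(1)[OF p]] gc[OF index_rel(1)[OF p]]
            measurable_compose[OF gc[OF index_rel(2)[OF p]] f_measurable[OF p]]])
  qed
  have cons_AE: "AE z in \<Lambda>. cons z"
    unfolding cons_def
  proof (subst AE_ball_countable[OF countable_rel], intro ballI)
    fix p assume "p \<in> r"
    then obtain I J where p: "p = (I, J)" "(I, J) \<in> r" by (cases p) auto
    have IJ: "I \<in> D" "J \<in> D" using index_rel[OF p(2)] by auto
    let ?F = "{I, J}"
    have c: "\<forall>i\<in>?F. (i, J) \<in> r" using p rel_refl[OF IJ(2)] by auto
    have gF: "(\<lambda>z. g i (z i)) \<in> PiM ?F (\<lambda>_. borel) \<rightarrow>\<^sub>M borel_of (X i)" if "i \<in> ?F" for i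
    proof -
      have "(\<lambda>z. z i) \<in> PiM ?F (\<lambda>_. borel :: (nat \<Rightarrow> real) measure) \<rightarrow>\<^sub>M borel"
        by (rule measurable_component_singleton[OF that])
      moreover have "i \<in> D" using that IJ by auto
      ultimately show ?thesis using measurable_compose[OF _ g] by blast
    qed
    have "Measurable.pred (PiM ?F (\<lambda>_. borel)) (\<lambda>z. g I (z I) = f J I (g J (z J)))"
      by (intro pred_eq_polish[OF polish[OF IJ(1)]] measurable_compose[OF gF f_measurable[OF p(2)]] gF) auto
    then have S: "{z \<in> space (PiM ?F (\<lambda>_. borel)). g I (z I) = f J I (g J (z J))} \<in> sets (PiM ?F (\<lambda>_. borel))"
      by (simp add: pred_def)
    have QF: "Q ?F = distr (\<mu> J) (PiM ?F (\<lambda>_. borel)) (q ?F J)"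
      using IJ c by (intro Q_eq) auto
    have "AE z in Q ?F. g I (z I) = f J I (g J (z J))"
      unfolding QF AE_distr_iff[OF q_mu[OF c IJ(2)] S]
    proof (rule AE_I2)
      fix x assume "x \<in> space (\<mu> J)"
      then have x: "x \<in> topspace (X J)" using space_mu IJ by simp
      show "g I (q ?F J x I) = f J I (g J (q ?F J x J))"
        using f_topspace[OF p(2) x] x IJ by (simp add: q_def ge f_id)
    qed
    moreover have FD: "?F \<subseteq> D" using IJ by auto
    ultimately have "AE z in distr \<Lambda> (PiM ?F (\<lambda>_. borel)) (\<lambda>z. restrict z ?F). g I (z I) = f J I (g J (z J))"
      by (subst marg) simp_all
    then have "AE z in \<Lambda>. g I (restrict z ?F I) = f J I (g J (restrict z ?F J))"
      unfolding AE_distr_iff[OF restr_L[OF FD] S] .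
    then show "AE z in \<Lambda>. g (fst p) (z (fst p)) = f (snd p) (fst p) (g (snd p) (z (snd p)))"
      by (simp add: p)
  qed
  have gX: "g I z \<in> topspace (X I)" if "I \<in> D" for I z
    using measurable_space[OF g[OF that], of z] by simp
  have cons_L: "(\<lambda>I\<in>D. g I (z I)) \<in> L" if z: "cons z" for z
    unfolding proj_lim_set_def
  proof (intro CollectI conjI allI impI)
    show "(\<lambda>I\<in>D. g I (z I)) \<in> (\<Pi>\<^sub>E I\<in>D. topspace (X I))" using gX by auto
    fix I J assume IJ: "(I, J) \<in> r"
    show "(\<lambda>I\<in>D. g I (z I)) I = f J I ((\<lambda>I\<in>D. g I (z I)) J)"
      using z bspec[OF z[unfolded cons_def] IJ] index_rel[OF IJ] by simp
  qed
  obtain z0 where z0: "cons z0"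
  proof -
    have "\<not> (AE z in \<Lambda>. False)" by (simp add: \<Lambda>.AE_False)
    then have "\<exists>z. cons z" using cons_AE by (metis (mono_tags, lifting) AE_cong)
    then show ?thesis using that by blast
  qed
  \<comment> \<open>On the null set of inconsistent points \<open>h\<close> is constant, so that it maps into the limit
      everywhere.\<close>
  define h where "h z = (\<lambda>I\<in>D. g I ((if cons z then z else z0) I))" for z
  have h_L: "h z \<in> L" for z
    unfolding h_def using cons_L[of "if cons z then z else z0"] z0 by auto
  have hI: "h z I = (if cons z then g I (z I) else g I (z0 I))" if "I \<in> D" for z I
    using that by (simp add: h_def)
  have h_meas: "h \<in> \<Lambda> \<rightarrow>\<^sub>M borel_of XD"
  proof (rule measurable_into_XD)
    show "h \<in> space \<Lambda> \<rightarrow> L" using h_L by auto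
    fix I assume I: "I \<in> D"
    show "(\<lambda>w. h w I) \<in> \<Lambda> \<rightarrow>\<^sub>M borel_of (X I)"
      unfolding hI[OF I] using gX[OF I]
      by (intro measurable_If gc I measurable_const) (use cons_meas in \<open>auto simp: pred_def\<close>)
  qed
  show ?thesis
  proof
    show "prob_space (distr \<Lambda> (borel_of XD) h)"
      by (rule \<Lambda>.prob_space_distr[OF h_meas])
    show "sets (distr \<Lambda> (borel_of XD) h) = sets (borel_of XD)" by simp
    fix I assume I: "I \<in> D"
    have gI: "(\<lambda>z. g I (z I)) \<in> PiM {I} (\<lambda>_. borel) \<rightarrow>\<^sub>M borel_of (X I)"
    proof -
      have "(\<lambda>z. z I) \<in> PiM {I} (\<lambda>_. borel :: (nat \<Rightarrow> real) measure) \<rightarrow>\<^sub>M borel"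
        by (rule measurable_component_singleton) simp
      then show ?thesis using measurable_compose[OF _ g[OF I]] by blast
    qed
    have "distr (distr \<Lambda> (borel_of XD) h) (borel_of (X I)) (\<lambda>x. x I)
        = distr \<Lambda> (borel_of (X I)) ((\<lambda>x. x I) \<circ> h)"
      by (intro distr_distr coord_measurable I h_meas)
    also have "\<dots> = distr \<Lambda> (borel_of (X I)) ((\<lambda>z. g I (z I)) \<circ> (\<lambda>z. restrict z {I}))"
    proof (rule distr_cong_AE)
      show "AE x in \<Lambda>. ((\<lambda>x. x I) \<circ> h) x = ((\<lambda>z. g I (z I)) \<circ> (\<lambda>z. restrict z {I})) x"
        using cons_AE by eventually_elim (simp add: hI[OF I])
      show "(\<lambda>x. x I) \<circ> h \<in> \<Lambda> \<rightarrow>\<^sub>M borel_of (X I)"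
        using h_meas coord_measurable[OF I] by (rule measurable_comp)
      show "(\<lambda>z. g I (z I)) \<circ> (\<lambda>z. restrict z {I}) \<in> \<Lambda> \<rightarrow>\<^sub>M borel_of (X I)"
        using restr_L[of "{I}"] I gI by (intro measurable_comp) auto
    qed simp_all
    also have "\<dots> = distr (distr \<Lambda> (PiM {I} (\<lambda>_. borel)) (\<lambda>z. restrict z {I})) (borel_of (X I)) (\<lambda>z. g I (z I))"
      using restr_L[of "{I}"] I gI by (intro distr_distr[symmetric]) auto
    also have "\<dots> = distr (distr (\<mu> I) (PiM {I} (\<lambda>_. borel)) (q {I} I)) (borel_of (X I)) (\<lambda>z. g I (z I))"
      using marg[of "{I}"] Q_eq[of "{I}" I] I rel_refl[OF I] by simp
    also have "\<dots> = distr (\<mu> I) (borel_of (X I)) ((\<lambda>z. g I (z I)) \<circ> q {I} I)"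
      using I rel_refl[OF I] by (intro distr_distr gI q_mu) auto
    also have "\<dots> = distr (\<mu> I) (\<mu> I) (\<lambda>x. x)"
      using space_mu[OF I] I by (intro distr_cong) (auto simp: q_def ge f_id sets_mu)
    also have "\<dots> = \<mu> I" by (rule distr_id)
    finally show "distr (distr \<Lambda> (borel_of XD) h) (borel_of (X I)) (\<lambda>x. x I) = \<mu> I" .
  qed
qed

section \<open>Lifting a tight limit measure to a compactly injected space\<close>

text \<open>The points of \<open>K\<close> that agree with \<open>x\<close> at the coordinate \<open>I\<close> form a nonempty closed subset of
  \<open>K\<close>, which shrinks as \<open>I\<close> grows. As the indices are directed, these sets have the finite
  intersection property, and compactness gives a point that agrees with \<open>x\<close> everywhere.\<close>
lemma mem_image_if_coordinates:
  assumes T: "continuous_map T XD \<phi>" and K: "compactin T K"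
    and x: "x \<in> L" "\<And>I. I \<in> D \<Longrightarrow> x I \<in> (\<lambda>t. \<phi> t I) ` K"
  shows "x \<in> \<phi> ` K"
proof -
  define C where "C I = {t \<in> topspace T. \<phi> t I \<in> {x I}}" for I
  have KT: "K \<subseteq> topspace T" using K by (simp add: compactin_def)
  have \<phi>L: "\<phi> t \<in> L" if "t \<in> topspace T" for t
    using T that topspace_XD by (auto simp: continuous_map_def)
  have "closedin T (C I)" if I: "I \<in> D" for I
    unfolding C_def
  proof (rule closedin_continuous_map_preimage)
    show "continuous_map T (X I) (\<lambda>t. \<phi> t I)"
      using continuous_map_compose[OF T continuous_coord[OF I]] by (simp add: comp_def)
    show "closedin (X I) {x I}"
      using polish_imp_Hausdorff[OF polish[OF I]] coord_topspace[OF x(1) I]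
      by (intro closedin_Hausdorff_singleton)
  qed
  moreover have "K \<inter> \<Inter>F \<noteq> {}" if F: "finite F" "F \<subseteq> C ` D" for F
  proof -
    obtain J where J: "finite J" "J \<subseteq> D" "F = C ` J"
      using finite_subset_image[OF F] by blast
    obtain H where H: "H \<in> D" "\<forall>I\<in>J. (I, H) \<in> r" using finite_upper_bound[OF J(1,2)] by blast
    obtain t where t: "t \<in> K" "x H = \<phi> t H" using x(2)[OF H(1)] by blast
    then have tT: "t \<in> topspace T" using KT by blast
    have "t \<in> C I" if "I \<in> J" for I
    proof -
      have IH: "(I, H) \<in> r" using that H by blast
      show ?thesis
        using coord_rel[OF x(1) IH] coord_rel[OF \<phi>L[OF tT] IH] t(2) tT by (simp add: C_def)
    qed
    then show ?thesis using t(1) J(3) by blast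
  qed
  ultimately have "K \<inter> \<Inter>(C ` D) \<noteq> {}"
    using K unfolding compactin_fip by (metis (no_types, lifting) imageE)
  then obtain t where t: "t \<in> K" "\<And>I. I \<in> D \<Longrightarrow> \<phi> t I = x I" by (auto simp: C_def)
  then have "\<phi> t = x" using \<phi>L KT x(1) by (intro L_eqI) auto
  then show ?thesis using t(1) by blast
qed

lemma compact_image_closedin_XD:
  assumes "continuous_map T XD \<phi>" "compactin T K"
  shows "closedin XD (\<phi> ` K)"
  using image_compactin[OF assms(2,1)] Hausdorff_XD by (rule compactin_imp_closedin[rotated])

lemma compact_image_coord_sets:
  assumes "continuous_map T XD \<phi>" "compactin T K" "I \<in> D"
  shows "(\<lambda>t. \<phi> t I) ` K \<in> sets (borel_of (X I))"
proof -
  have "continuous_map T (X I) (\<lambda>t. \<phi> t I)"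
    using continuous_map_compose[OF assms(1) continuous_coord[OF assms(3)]] by (simp add: comp_def)
  from image_compactin[OF assms(2) this] show ?thesis
    using polish_imp_Hausdorff[OF polish[OF assms(3)]]
    by (intro closedin_sets_borel_of compactin_imp_closedin)
qed

text \<open>By the previous lemmas \<open>\<phi> ` K\<close> is the intersection of the cylinders over the coordinate
  images of \<open>K\<close>. Along a cofinal sequence of indices these decrease, so the bound on the
  marginals passes to the limit.\<close>
lemma measure_compact_image_ge:
  assumes T: "continuous_map T XD \<phi>" and K: "compactin T K"
    and \<nu>: "prob_space \<nu>" "sets \<nu> = sets (borel_of XD)"
    and mass: "\<And>I. I \<in> D \<Longrightarrow> measure (distr \<nu> (borel_of (X I)) (\<lambda>x. x I)) ((\<lambda>t. \<phi> t I) ` K) \<ge> a"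
  shows "measure \<nu> (\<phi> ` K) \<ge> a"
proof -
  interpret prob_space \<nu> by fact
  obtain c where c: "\<And>n. c n \<in> D" "\<And>n. (c n, c (Suc n)) \<in> r" "\<And>I. I \<in> D \<Longrightarrow> \<exists>n. (I, c n) \<in> r"
    using cofinal_chain by metis
  have KT: "K \<subseteq> topspace T" using K by (simp add: compactin_def)
  have \<phi>L: "\<phi> t \<in> L" if "t \<in> K" for t
    using T that KT topspace_XD by (auto simp: continuous_map_def)
  define B where "B n = {x \<in> L. x (c n) \<in> (\<lambda>t. \<phi> t (c n)) ` K}" for n
  have cs: "(\<lambda>t. \<phi> t I) ` K \<in> sets (borel_of (X I))" if "I \<in> D" for I
    using compact_image_coord_sets[OF T K that] .
  have Bs: "B n \<in> sets \<nu>" for n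
    unfolding B_def \<nu>(2) by (intro cylinder_sets c cs)
  have step: "x I \<in> (\<lambda>t. \<phi> t I) ` K"
    if "x \<in> L" "(I, J) \<in> r" "x J \<in> (\<lambda>t. \<phi> t J) ` K" for x I J
  proof -
    from that(3) obtain t where t: "t \<in> K" "x J = \<phi> t J" by blast
    have "x I = \<phi> t I" using coord_rel[OF that(1,2)] coord_rel[OF \<phi>L[OF t(1)] that(2)] t(2) by simp
    then show ?thesis using t(1) by blast
  qed
  have "decseq B"
    using step[OF _ c(2)] by (intro decseq_SucI) (auto simp: B_def)
  then have lim: "(\<lambda>n. measure \<nu> (B n)) \<longlonglongrightarrow> measure \<nu> (\<Inter>n. B n)"
    using Bs by (intro finite_Lim_measure_decseq) auto
  have "(\<Inter>n. B n) = \<phi> ` K"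
  proof
    show "\<phi> ` K \<subseteq> (\<Inter>n. B n)" using \<phi>L by (auto simp: B_def)
    show "(\<Inter>n. B n) \<subseteq> \<phi> ` K"
    proof
      fix x assume "x \<in> (\<Inter>n. B n)"
      then have x: "x \<in> L" "\<And>n. x (c n) \<in> (\<lambda>t. \<phi> t (c n)) ` K" by (auto simp: B_def)
      have "x I \<in> (\<lambda>t. \<phi> t I) ` K" if "I \<in> D" for I
        using c(3)[OF that] step[OF x(1) _ x(2)] by blast
      then show "x \<in> \<phi> ` K" using mem_image_if_coordinates[OF T K x(1)] by blast
    qed
  qed
  moreover have "measure \<nu> (B n) \<ge> a" for n
    using mass[OF c(1)[of n]] marginal_emeasure[OF c(1) cs[OF c(1)] \<nu>(2), of n]
    by (simp add: measure_def B_def)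
  ultimately show ?thesis
    using LIMSEQ_le_const[OF lim, of a] by auto
qed

text \<open>The measure \<open>\<nu>\<close> is concentrated on the image of a \<open>\<sigma>\<close>-compact set \<open>S\<close>. There the inverse of
  \<open>\<phi>\<close> is Borel measurable, although \<open>\<phi>\<close> need not be an embedding of \<open>T\<close>. Any measure with image \<open>\<nu>\<close>
  is therefore concentrated on \<open>S\<close> as well, and a Borel subset of \<open>S\<close> is the \<open>\<phi>\<close>-preimage of its own
  Borel image; this determines the measure.\<close>
theorem tight_measure_lift:
  assumes Tcont: "continuous_map T XD \<phi>" and haus: "Hausdorff_space T"
    and inj: "inj_on \<phi> (topspace T)"
    and \<nu>: "prob_space \<nu>" "sets \<nu> = sets (borel_of XD)"
    and tight: "\<And>\<epsilon>. \<epsilon> > 0 \<Longrightarrow> \<exists>K. compactin T K \<and>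
      (\<forall>I\<in>D. measure (distr \<nu> (borel_of (X I)) (\<lambda>x. x I)) ((\<lambda>t. \<phi> t I) ` K) > 1 - \<epsilon>)"
  obtains \<mu> where "prob_space \<mu>" "sets \<mu> = sets (borel_of T)" "distr \<mu> (borel_of XD) \<phi> = \<nu>"
    "radon_measure T \<mu>"
    "\<And>\<mu>'. sets \<mu>' = sets (borel_of T) \<Longrightarrow> distr \<mu>' (borel_of XD) \<phi> = \<nu> \<Longrightarrow> \<mu>' = \<mu>"
proof -
  interpret \<nu>: prob_space \<nu> by fact
  have space_\<nu>: "space \<nu> = L" using sets_eq_imp_space_eq[OF \<nu>(2)] topspace_XD by simp
  have \<phi>L: "\<phi> t \<in> L" if "t \<in> topspace T" for t
    using Tcont that topspace_XD by (auto simp: continuous_map_def)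
  have "\<exists>K. compactin T K \<and> measure \<nu> (\<phi> ` K) \<ge> 1 - inverse (real (Suc n))" for n
    using tight[of "inverse (real (Suc n))"] measure_compact_image_ge[OF Tcont _ \<nu>]
    by (metis inverse_positive_iff_positive less_imp_le of_nat_0_less_iff zero_less_Suc)
  then obtain K0 where K0: "\<And>n. compactin T (K0 n)"
    "\<And>n. measure \<nu> (\<phi> ` K0 n) \<ge> 1 - inverse (real (Suc n))" by metis
  define K where "K n = (\<Union>i\<le>n. K0 i)" for n
  have K: "compactin T (K n)" for n
    unfolding K_def by (intro compactin_Union) (use K0 in auto)
  have Kmono: "incseq K" unfolding K_def incseq_def by (intro allI impI UN_mono) auto
  define S where "S = (\<Union>n. K n)"
  have KT: "K n \<subseteq> topspace T" for n using K[of n] by (simp add: compactin_def)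
  then have ST: "S \<subseteq> topspace T" by (auto simp: S_def)
  have closed_image: "closedin XD (\<phi> ` (F \<inter> K n))" if "closedin T F" for F n
    using closed_Int_compactin[OF that K] by (rule compact_image_closedin_XD[OF Tcont])
  have KB: "\<phi> ` K n \<in> sets (borel_of XD)" for n
    by (intro closedin_sets_borel_of compact_image_closedin_XD[OF Tcont] K)
  have imS: "\<phi> ` S = (\<Union>n. \<phi> ` K n)" by (auto simp: S_def)
  have SB: "\<phi> ` S \<in> sets (borel_of XD)" unfolding imS using KB by blast
  have S1: "measure \<nu> (\<phi> ` S) = 1"
  proof (rule antisym)
    show "measure \<nu> (\<phi> ` S) \<le> 1" by simp
    have "measure \<nu> (\<phi> ` S) \<ge> 1 - inverse (real (Suc n))" for n
    proof -
      have "measure \<nu> (\<phi> ` K0 n) \<le> measure \<nu> (\<phi> ` S)"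
        using SB \<nu>(2) by (intro \<nu>.finite_measure_mono) (auto simp: S_def K_def)
      then show ?thesis using K0(2)[of n] by simp
    qed
    moreover have "(\<lambda>n. 1 - inverse (real (Suc n))) \<longlonglongrightarrow> 1 - 0"
      by (intro tendsto_diff tendsto_const LIMSEQ_inverse_real_of_nat)
    ultimately show "1 \<le> measure \<nu> (\<phi> ` S)"
      using LIMSEQ_le_const2[of "\<lambda>n. 1 - inverse (real (Suc n))" 1 "measure \<nu> (\<phi> ` S)"] by auto
  qed
  have AE_S: "AE x in \<nu>. x \<in> \<phi> ` S"
    using S1 SB \<nu>(2) by (subst \<nu>.prob_eq_1[symmetric]) auto
  have "S \<noteq> {}" using S1 by auto
  then obtain t0 where t0: "t0 \<in> S" by auto
  \<comment> \<open>The inverse of \<open>\<phi>\<close> on \<open>\<phi> ` S\<close>; its value outside this set of full measure is arbitrary.\<close>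
  define \<psi> where "\<psi> x = (if x \<in> \<phi> ` S then the_inv_into (topspace T) \<phi> x else t0)" for x
  have \<psi>\<phi>: "\<psi> (\<phi> t) = t" if "t \<in> S" for t
    using that ST inj by (auto simp: \<psi>_def the_inv_into_f_f)
  have \<psi>_meas: "\<psi> \<in> borel_of XD \<rightarrow>\<^sub>M borel_of T"
  proof (rule measurable_borel_of_closedin)
    show "\<psi> \<in> space (borel_of XD) \<rightarrow> topspace T"
    proof
      fix x assume "x \<in> space (borel_of XD)"
      show "\<psi> x \<in> topspace T"
      proof (cases "x \<in> \<phi> ` S")
        case True
        then show ?thesis using \<psi>\<phi> ST by auto
      next
        case False
        then show ?thesis using t0 ST by (auto simp: \<psi>_def)
      qed
    qed
    fix F assume F: "closedin T F"
    have "\<psi> -` F \<inter> space (borel_of XD)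
        = (\<Union>n. \<phi> ` (F \<inter> K n)) \<union> (if t0 \<in> F then space (borel_of XD) - \<phi> ` S else {})"
    proof (intro equalityI subsetI)
      fix x assume x: "x \<in> \<psi> -` F \<inter> space (borel_of XD)"
      show "x \<in> (\<Union>n. \<phi> ` (F \<inter> K n)) \<union> (if t0 \<in> F then space (borel_of XD) - \<phi> ` S else {})"
      proof (cases "x \<in> \<phi> ` S")
        case True
        then obtain t where t: "t \<in> S" "x = \<phi> t" by blast
        then have "t \<in> F" using x \<psi>\<phi> by auto
        then show ?thesis using t by (auto simp: S_def)
      next
        case False
        then show ?thesis using x by (auto simp: \<psi>_def)
      qed
    next
      fix x assume x: "x \<in> (\<Union>n. \<phi> ` (F \<inter> K n)) \<union> (if t0 \<in> F then space (borel_of XD) - \<phi> ` S else {})"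
      show "x \<in> \<psi> -` F \<inter> space (borel_of XD)"
      proof (cases "x \<in> \<phi> ` S")
        case True
        then obtain n t where "t \<in> F" "t \<in> K n" "x = \<phi> t" using x by (auto split: if_splits)
        moreover from this have "t \<in> S" "t \<in> topspace T" using KT by (auto simp: S_def)
        ultimately show ?thesis using \<psi>\<phi> \<phi>L by (simp add: topspace_XD)
      next
        case False
        then show ?thesis using x imS by (auto simp: \<psi>_def split: if_splits)
      qed
    qed
    also have "\<dots> \<in> sets (borel_of XD)"
    proof (rule sets.Un)
      show "(\<Union>n. \<phi> ` (F \<inter> K n)) \<in> sets (borel_of XD)"
        using closedin_sets_borel_of[OF closed_image[OF F]] by (intro sets.countable_UN) auto
      show "(if t0 \<in> F then space (borel_of XD) - \<phi> ` S else {}) \<in> sets (borel_of XD)"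
        using sets.compl_sets[OF SB] by simp
    qed
    finally show "\<psi> -` F \<inter> space (borel_of XD) \<in> sets (borel_of XD)" .
  qed
  have \<phi>_meas: "\<phi> \<in> borel_of T \<rightarrow>\<^sub>M borel_of XD"
    using Tcont by (rule continuous_map_borel_of_measurable)
  have image_B: "\<phi> ` (A \<inter> S) \<in> sets (borel_of XD)" if A: "A \<in> sets (borel_of T)" for A
  proof -
    have "\<phi> ` (A \<inter> S) = (\<psi> -` A \<inter> space (borel_of XD)) \<inter> \<phi> ` S"
      using \<psi>\<phi> \<phi>L ST by (auto simp: topspace_XD)
    then show ?thesis using measurable_sets[OF \<psi>_meas A] SB by simp
  qed
  have preimage: "\<phi> -` \<phi> ` B \<inter> topspace T = B" if "B \<subseteq> topspace T" for B
    using that inj by (auto simp: inj_on_def)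
  \<comment> \<open>Proved for every measure with image \<open>\<nu>\<close>, so that it gives uniqueness and also evaluates
      the measure constructed below.\<close>
  have formula: "emeasure \<mu>' A = emeasure \<nu> (\<phi> ` (A \<inter> S))"
    if \<mu>': "sets \<mu>' = sets (borel_of T)" "distr \<mu>' (borel_of XD) \<phi> = \<nu>" and A: "A \<in> sets (borel_of T)"
    for \<mu>' A
  proof -
    have sp: "space \<mu>' = topspace T" using sets_eq_imp_space_eq[OF \<mu>'(1)] by simp
    have m: "\<phi> \<in> \<mu>' \<rightarrow>\<^sub>M borel_of XD" using \<phi>_meas measurable_cong_sets[OF \<mu>'(1) refl] by blast
    have pull: "emeasure \<mu>' B = emeasure \<nu> (\<phi> ` B)" if "\<phi> ` B \<in> sets (borel_of XD)" "B \<subseteq> topspace T" for B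
      using emeasure_distr[OF m that(1)] preimage[OF that(2)] \<mu>'(2) sp by simp
    have "\<phi> -` space (borel_of XD) \<inter> space \<mu>' = space \<mu>'"
      using measurable_space[OF m] by auto
    then have "emeasure \<mu>' (space \<mu>') = emeasure (distr \<mu>' (borel_of XD) \<phi>) (space (borel_of XD))"
      using emeasure_distr[OF m sets.top] by simp
    also have "\<dots> = 1"
      using \<nu>.emeasure_space_1 by (simp only: \<mu>'(2) space_\<nu> space_borel_of topspace_XD)
    finally have "emeasure \<mu>' (space \<mu>') = 1" .
    then interpret \<mu>': prob_space \<mu>' by (rule prob_spaceI)
    have S: "S \<in> sets \<mu>'"
      using measurable_sets[OF m SB] preimage[OF ST] sp by simp
    have "emeasure \<mu>' S = 1"
      using pull[OF SB ST] S1 by (simp add: \<nu>.emeasure_eq_measure)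
    then have "AE t in \<mu>'. t \<in> S"
      using S by (simp add: \<mu>'.AE_in_set_eq_1 \<mu>'.emeasure_eq_measure)
    then have "emeasure \<mu>' A = emeasure \<mu>' (A \<inter> S)"
      using A S \<mu>'(1) by (intro emeasure_eq_AE) auto
    then show ?thesis using pull[OF image_B[OF A]] ST by auto
  qed
  define \<mu> where "\<mu> = distr \<nu> (borel_of T) \<psi>"
  have \<psi>_\<nu>: "\<psi> \<in> \<nu> \<rightarrow>\<^sub>M borel_of T" using \<psi>_meas measurable_cong_sets[OF \<nu>(2) refl] by blast
  have sets_\<mu>: "sets \<mu> = sets (borel_of T)" by (simp add: \<mu>_def)
  have prob_\<mu>: "prob_space \<mu>" unfolding \<mu>_def by (rule \<nu>.prob_space_distr[OF \<psi>_\<nu>])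
  have "distr \<mu> (borel_of XD) \<phi> = distr \<nu> (borel_of XD) (\<phi> \<circ> \<psi>)"
    unfolding \<mu>_def using \<phi>_meas \<psi>_\<nu> by (rule distr_distr)
  also have "\<dots> = distr \<nu> \<nu> (\<lambda>x. x)"
  proof (rule distr_cong_AE)
    show "AE x in \<nu>. (\<phi> \<circ> \<psi>) x = x" using AE_S by eventually_elim (auto simp: \<psi>\<phi>)
    show "\<phi> \<circ> \<psi> \<in> \<nu> \<rightarrow>\<^sub>M borel_of XD" using \<psi>_\<nu> \<phi>_meas by (rule measurable_comp)
  qed (use \<nu>(2) in auto)
  also have "\<dots> = \<nu>" by (rule distr_id)
  finally have distr_\<mu>: "distr \<mu> (borel_of XD) \<phi> = \<nu>" .
  interpret \<mu>: prob_space \<mu> by (rule prob_\<mu>)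
  have space_\<mu>: "space \<mu> = topspace T" using sets_eq_imp_space_eq[OF sets_\<mu>] by simp
  have "radon_measure T \<mu>"
    unfolding radon_measure_def
  proof (intro conjI ballI)
    show "sets \<mu> = sets (borel_of T)" by (rule sets_\<mu>)
    fix x assume "x \<in> topspace T"
    then show "\<exists>U. openin T U \<and> x \<in> U \<and> emeasure \<mu> U < \<infinity>"
      by (intro exI[of _ "topspace T"]) (simp add: \<mu>.emeasure_eq_measure)
  next
    fix A assume A': "A \<in> sets \<mu>"
    then have A: "A \<in> sets (borel_of T)" using sets_\<mu> by simp
    have "L \<noteq> {}" using \<nu>.not_empty space_\<nu> by simp
    then obtain e :: "'i \<Rightarrow> 'x \<Rightarrow> nat \<Rightarrow> real"
      where e: "\<And>I. I \<in> D \<Longrightarrow> X I = pullback_topology (topspace (X I)) (e I) euclidean"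
      using coordinate_embeddings by metis
    \<comment> \<open>Inner regularity holds for measures on Polish types, so \<open>\<nu>\<close> is pushed forward along an
        embedding \<open>E\<close> of the limit.\<close>
    define E where "E = (\<lambda>x n. e (from_nat_into D n) (x (from_nat_into D n)))"
    have E: "XD = pullback_topology (topspace XD) E euclidean"
      unfolding E_def by (rule XD_pullback[OF e])
    have Einj: "inj_on E L"
      using pullback_topology_Hausdorff_inj[OF Hausdorff_XD E] topspace_XD by simp
    have Econt: "continuous_map XD euclidean E"
      unfolding continuous_map_alt
      using openin_pullback_topology[of "topspace XD" E euclidean] E by auto
    have Emeas: "E \<in> \<nu> \<rightarrow>\<^sub>M borel"
      using measurable_vimage_algebra1[of E "topspace XD" borel]
        measurable_cong_sets[OF trans[OF \<nu>(2) sets_borel_of_pullback[OF E]] refl, of borel] by auto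
    have E\<phi>: "continuous_map T euclidean (\<lambda>t. E (\<phi> t))"
      using continuous_map_compose[OF Tcont Econt] by (simp add: comp_def)
    define \<eta> where "\<eta> = distr \<nu> borel E"
    interpret \<eta>: prob_space \<eta> unfolding \<eta>_def by (rule \<nu>.prob_space_distr[OF Emeas])
    have \<eta>_pull: "emeasure \<eta> C = emeasure \<mu> {t \<in> topspace T. E (\<phi> t) \<in> C}" if "C \<in> sets borel" for C
    proof -
      have "emeasure \<eta> C = emeasure \<nu> (E -` C \<inter> space \<nu>)"
        unfolding \<eta>_def by (rule emeasure_distr[OF Emeas that])
      also have "\<dots> = emeasure (distr \<mu> (borel_of XD) \<phi>) (E -` C \<inter> space \<nu>)"
        by (simp add: distr_\<mu>)
      also have "\<dots> = emeasure \<mu> (\<phi> -` (E -` C \<inter> space \<nu>) \<inter> space \<mu>)"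
        using \<phi>_meas measurable_sets[OF Emeas that] \<nu>(2)
        by (intro emeasure_distr) (auto simp: measurable_cong_sets[OF sets_\<mu> refl])
      also have "\<phi> -` (E -` C \<inter> space \<nu>) \<inter> space \<mu> = {t \<in> topspace T. E (\<phi> t) \<in> C}"
        using \<phi>L by (auto simp: space_\<mu> space_\<nu>)
      finally show ?thesis .
    qed
    show "emeasure \<mu> A = (SUP C\<in>{C. compactin T C \<and> C \<subseteq> A}. emeasure \<mu> C)"
    proof (rule antisym)
      show "(SUP C\<in>{C. compactin T C \<and> C \<subseteq> A}. emeasure \<mu> C) \<le> emeasure \<mu> A"
        using A' by (intro SUP_least emeasure_mono) auto
      have Ks: "K n \<in> sets (borel_of T)" for n
        by (intro closedin_sets_borel_of compactin_imp_closedin haus K)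
      have part: "emeasure \<mu> (A \<inter> K n) \<le> (SUP C\<in>{C. compactin T C \<and> C \<subseteq> A}. emeasure \<mu> C)" for n
      proof -
        let ?B = "(\<lambda>t. E (\<phi> t)) ` (A \<inter> K n)"
        have AK: "A \<inter> K n \<inter> S = A \<inter> K n" by (auto simp: S_def)
        have "\<phi> ` (A \<inter> K n) \<in> sets (borel_of XD)"
          using image_B[of "A \<inter> K n"] A Ks AK by auto
        then have "\<phi> ` (A \<inter> K n) \<in> sets (vimage_algebra (topspace XD) E borel)"
          using sets_borel_of_pullback[OF E] by simp
        \<comment> \<open>Inside the compact set \<open>E ` \<phi> ` K n\<close> the image of \<open>A \<inter> K n\<close> is cut out by a Borel set of the
            ambient type, so it is Borel there too.\<close>
        then obtain W where W: "W \<in> sets borel" "\<phi> ` (A \<inter> K n) = E -` W \<inter> topspace XD"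
          by (subst (asm) sets_vimage_algebra2) auto
        have "compactin euclidean ((\<lambda>t. E (\<phi> t)) ` K n)"
          by (rule image_compactin[OF K E\<phi>])
        then have "(\<lambda>t. E (\<phi> t)) ` K n \<in> sets borel"
          by (simp add: compact_imp_closed borel_closed)
        moreover have "?B = W \<inter> (\<lambda>t. E (\<phi> t)) ` K n"
        proof (intro equalityI subsetI)
          fix z assume "z \<in> W \<inter> (\<lambda>t. E (\<phi> t)) ` K n"
          then obtain t where t: "t \<in> K n" "z = E (\<phi> t)" "z \<in> W" by blast
          have "t \<in> topspace T" using t(1) KT by blast
          then have "\<phi> t \<in> E -` W \<inter> topspace XD" using \<phi>L t by (simp add: topspace_XD)
          then have "\<phi> t \<in> \<phi> ` (A \<inter> K n)" using W(2) by simp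
          then obtain s where "s \<in> A \<inter> K n" "\<phi> t = \<phi> s" by blast
          then have "z = E (\<phi> s)" using t(2) by simp
          then show "z \<in> ?B" using \<open>s \<in> A \<inter> K n\<close> by blast
        next
          fix z assume "z \<in> ?B"
          then show "z \<in> W \<inter> (\<lambda>t. E (\<phi> t)) ` K n" using W(2) by blast
        qed
        ultimately have B: "?B \<in> sets borel" using W(1) by simp
        have inj': "t \<in> A \<inter> K n" if "t \<in> topspace T" "E (\<phi> t) \<in> ?B" for t
        proof -
          from that(2) obtain s where s: "s \<in> A \<inter> K n" "E (\<phi> t) = E (\<phi> s)" by blast
          have sT: "s \<in> topspace T" using s(1) KT by blast
          have "\<phi> t = \<phi> s" using inj_onD[OF Einj s(2) \<phi>L[OF that(1)] \<phi>L[OF sT]] .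
          then have "t = s" using inj_onD[OF inj _ that(1) sT] by blast
          then show ?thesis using s(1) by simp
        qed
        have "{t \<in> topspace T. E (\<phi> t) \<in> ?B} = A \<inter> K n"
          using inj' KT by blast
        then have "emeasure \<mu> (A \<inter> K n) = emeasure \<eta> ?B"
          using \<eta>_pull[OF B] by simp
        also have "\<dots> = (SUP C\<in>{C. C \<subseteq> ?B \<and> compact C}. emeasure \<eta> C)"
          by (rule inner_regular) (use B \<eta>.emeasure_space_1 in \<open>auto simp: \<eta>_def\<close>)
        also have "\<dots> \<le> (SUP C\<in>{C. compactin T C \<and> C \<subseteq> A}. emeasure \<mu> C)"
        proof (rule SUP_least)
          fix C assume "C \<in> {C. C \<subseteq> ?B \<and> compact C}"
          then have C: "C \<subseteq> ?B" "compact C" by auto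
          let ?C = "{t \<in> topspace T. E (\<phi> t) \<in> C}"
          have "closedin T ?C"
            using C(2) by (intro closedin_continuous_map_preimage[OF E\<phi>]) (simp add: compact_imp_closed)
          moreover have sub: "?C \<subseteq> A \<inter> K n" using inj' C(1) by blast
          ultimately have "compactin T ?C"
            using closed_compactin[OF K[of n]] by blast
          then have "emeasure \<mu> ?C \<le> (SUP C\<in>{C. compactin T C \<and> C \<subseteq> A}. emeasure \<mu> C)"
            using sub by (intro SUP_upper) auto
          then show "emeasure \<eta> C \<le> (SUP C\<in>{C. compactin T C \<and> C \<subseteq> A}. emeasure \<mu> C)"
            using \<eta>_pull[of C] C(2) by (simp add: compact_imp_closed borel_closed)
        qed
        finally show ?thesis .
      qed
      have "emeasure \<mu> (A \<inter> S) = emeasure \<mu> A"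
        using formula[OF sets_\<mu> distr_\<mu>, of "A \<inter> S"] formula[OF sets_\<mu> distr_\<mu> A] A Ks
        by (simp add: S_def Int_assoc)
      moreover have "A \<inter> S = (\<Union>n. A \<inter> K n)" by (auto simp: S_def)
      moreover have "(SUP n. emeasure \<mu> (A \<inter> K n)) = emeasure \<mu> (\<Union>n. A \<inter> K n)"
      proof (rule SUP_emeasure_incseq)
        show "range (\<lambda>n. A \<inter> K n) \<subseteq> sets \<mu>" using A Ks sets_\<mu> by auto
        show "incseq (\<lambda>n. A \<inter> K n)" using Kmono unfolding incseq_def by blast
      qed
      ultimately have "emeasure \<mu> A = (SUP n. emeasure \<mu> (A \<inter> K n))" by simp
      also have "\<dots> \<le> (SUP C\<in>{C. compactin T C \<and> C \<subseteq> A}. emeasure \<mu> C)"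
        by (intro SUP_least part)
      finally show "emeasure \<mu> A \<le> (SUP C\<in>{C. compactin T C \<and> C \<subseteq> A}. emeasure \<mu> C)" .
    qed
  qed
  moreover have "\<mu>' = \<mu>" if "sets \<mu>' = sets (borel_of T)" "distr \<mu>' (borel_of XD) \<phi> = \<nu>" for \<mu>'
    using formula[OF that] formula[OF sets_\<mu> distr_\<mu>] that(1) sets_\<mu>
    by (intro measure_eqI) auto
  ultimately show ?thesis
    using that[OF prob_\<mu> sets_\<mu> distr_\<mu>] by blast
qed

end

text \<open>Point masses serve as values of the kernel at those \<open>\<omega>\<close> where the marginals are tight but not
  consistent.\<close>
lemma radon_measure_return:
  assumes haus: "Hausdorff_space T" and t: "t \<in> topspace T"
  shows "radon_measure T (return (borel_of T) t)"
  unfolding radon_measure_def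
proof (intro conjI ballI)
  interpret prob_space "return (borel_of T) t"
    using t by (intro prob_space_return) simp
  fix x assume "x \<in> topspace T"
  then show "\<exists>U. openin T U \<and> x \<in> U \<and> emeasure (return (borel_of T) t) U < \<infinity>"
    by (intro exI[of _ "topspace T"]) (simp add: emeasure_eq_measure)
next
  let ?\<delta> = "return (borel_of T) t"
  fix A assume A: "A \<in> sets ?\<delta>"
  show "emeasure ?\<delta> A = (SUP K\<in>{K. compactin T K \<and> K \<subseteq> A}. emeasure ?\<delta> K)"
  proof (rule antisym)
    show "(SUP K\<in>{K. compactin T K \<and> K \<subseteq> A}. emeasure ?\<delta> K) \<le> emeasure ?\<delta> A"
      using A by (intro SUP_least emeasure_mono) auto
    have c: "compactin T (A \<inter> {t})" using t by (intro finite_imp_compactin) auto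
    then have "A \<inter> {t} \<in> sets (borel_of T)"
      using haus by (intro closedin_sets_borel_of compactin_imp_closedin)
    then have "emeasure ?\<delta> A = emeasure ?\<delta> (A \<inter> {t})"
      using A by (simp add: indicator_def)
    also have "\<dots> \<le> (SUP K\<in>{K. compactin T K \<and> K \<subseteq> A}. emeasure ?\<delta> K)"
      using c by (intro SUP_upper) auto
    finally show "emeasure ?\<delta> A \<le> (SUP K\<in>{K. compactin T K \<and> K \<subseteq> A}. emeasure ?\<delta> K)" .
  qed
qed simp

section \<open>Probability kernels and conditional probabilities\<close>

lemma polish_countable_generator:
  assumes T: "polish_topology (T :: 'a topology)" "topspace T \<noteq> {}"
  obtains G where "countable G" "Int_stable G" "G \<subseteq> Pow (topspace T)"
    "sets (borel_of T) = sigma_sets (topspace T) G" "topspace T \<in> G"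
proof -
  obtain e :: "'a \<Rightarrow> nat \<Rightarrow> real" where e: "T = pullback_topology (topspace T) e euclidean"
    using polish_topology_borel_retract[OF T] by metis
  obtain B :: "(nat \<Rightarrow> real) set set" where B: "countable B" "topological_basis B"
    using ex_countable_basis by blast
  define G where "G = (\<lambda>F. e -` \<Inter>F \<inter> topspace T) ` {F. finite F \<and> F \<subseteq> B}"
  show ?thesis
  proof
    show "countable G"
      unfolding G_def by (intro countable_image countable_Collect_finite_subset B)
    show "Int_stable G"
    proof (rule Int_stableI)
      fix a b assume "a \<in> G" "b \<in> G"
      then obtain F H where F: "finite F" "F \<subseteq> B" "a = e -` \<Inter>F \<inter> topspace T"
        and H: "finite H" "H \<subseteq> B" "b = e -` \<Inter>H \<inter> topspace T"
        unfolding G_def by blast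
      have "a \<inter> b = e -` \<Inter>(F \<union> H) \<inter> topspace T" unfolding F H by auto
      then show "a \<inter> b \<in> G" unfolding G_def using F H by (intro image_eqI[of _ _ "F \<union> H"]) auto
    qed
    show GP: "G \<subseteq> Pow (topspace T)" by (auto simp: G_def)
    show "topspace T \<in> G" unfolding G_def by (intro image_eqI[of _ _ "{}"]) auto
    have "sets (borel_of T) = sets (vimage_algebra (topspace T) e (sigma UNIV B))"
      using sets_borel_of_pullback[OF e] borel_eq_countable_basis[OF B] by simp
    also have "\<dots> = sigma_sets (topspace T) {e -` b \<inter> topspace T | b. b \<in> B}"
      by (subst vimage_algebra_sigma) (auto simp: sets_measure_of_conv)
    finally have R: "sets (borel_of T) = sigma_sets (topspace T) {e -` b \<inter> topspace T | b. b \<in> B}" .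
    show "sets (borel_of T) = sigma_sets (topspace T) G"
    proof
      have "a \<in> G" if ab: "a = e -` b \<inter> topspace T" "b \<in> B" for a b
        unfolding G_def using ab by (intro image_eqI[of _ _ "{b}"]) auto
      then show "sets (borel_of T) \<subseteq> sigma_sets (topspace T) G"
        unfolding R by (intro sigma_sets_mono') blast
      have "openin T (e -` \<Inter>F \<inter> topspace T)" if F: "finite F" "F \<subseteq> B" for F
      proof -
        have "open (\<Inter>F)"
          using F topological_basis_open[OF B(2)] by (intro open_Inter) auto
        then show ?thesis
          using openin_pullback_topology[of "topspace T" e euclidean] e by auto
      qed
      then have "G \<subseteq> sets (borel_of T)" by (auto simp: G_def sets_borel_of)
      then show "sigma_sets (topspace T) G \<subseteq> sets (borel_of T)"
        using sets.sigma_sets_subset[of G "borel_of T"] by simp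
    qed
  qed
qed

lemma kernel_sets:
  assumes "\<kappa> \<in> N \<rightarrow>\<^sub>M prob_algebra S" "\<omega> \<in> space N"
  shows "prob_space (\<kappa> \<omega>)" "sets (\<kappa> \<omega>) = sets S"
  using measurable_space[OF assms] by (auto simp: space_prob_algebra)

lemma kernel_emeasure_measurable:
  assumes "\<kappa> \<in> N \<rightarrow>\<^sub>M prob_algebra S" "A \<in> sets S"
  shows "(\<lambda>\<omega>. emeasure (\<kappa> \<omega>) A) \<in> borel_measurable N"
  using measurable_emeasure_kernel[OF measurable_prob_algebraD[OF assms(1)] assms(2)] .

lemma kernel_measure_measurable:
  assumes "\<kappa> \<in> N \<rightarrow>\<^sub>M prob_algebra S" "A \<in> sets S"
  shows "(\<lambda>\<omega>. measure (\<kappa> \<omega>) A) \<in> borel_measurable N"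
  unfolding measure_def using kernel_emeasure_measurable[OF assms] by measurable

text \<open>Two probability measures agree as soon as they agree on a countable intersection-stable
  generator, so equality is a countable conjunction of measurable conditions.\<close>
lemma kernels_eq_measurable:
  assumes T: "polish_topology T"
    and \<kappa>: "\<kappa>\<^sub>1 \<in> N \<rightarrow>\<^sub>M prob_algebra (borel_of T)" "\<kappa>\<^sub>2 \<in> N \<rightarrow>\<^sub>M prob_algebra (borel_of T)"
  shows "{\<omega> \<in> space N. \<kappa>\<^sub>1 \<omega> = \<kappa>\<^sub>2 \<omega>} \<in> sets N"
proof (cases "space N = {}")
  case False
  then obtain \<omega>0 where \<omega>0: "\<omega>0 \<in> space N" by blast
  have "topspace T \<noteq> {}"
    using prob_space.not_empty[OF kernel_sets(1)[OF \<kappa>(1) \<omega>0]]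
      sets_eq_imp_space_eq[OF kernel_sets(2)[OF \<kappa>(1) \<omega>0]] by auto
  then obtain G where G: "countable G" "Int_stable G" "G \<subseteq> Pow (topspace T)"
    "sets (borel_of T) = sigma_sets (topspace T) G" "topspace T \<in> G"
    using polish_countable_generator[OF T] by metis
  have GB: "A \<in> sets (borel_of T)" if "A \<in> G" for A using that G(4) by auto
  have "{\<omega> \<in> space N. \<kappa>\<^sub>1 \<omega> = \<kappa>\<^sub>2 \<omega>} = {\<omega> \<in> space N. \<forall>A\<in>G. emeasure (\<kappa>\<^sub>1 \<omega>) A = emeasure (\<kappa>\<^sub>2 \<omega>) A}"
  proof (intro Collect_cong conj_cong refl iffI)
    fix \<omega> assume \<omega>: "\<omega> \<in> space N" and eq: "\<forall>A\<in>G. emeasure (\<kappa>\<^sub>1 \<omega>) A = emeasure (\<kappa>\<^sub>2 \<omega>) A"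
    interpret prob_space "\<kappa>\<^sub>1 \<omega>" using kernel_sets[OF \<kappa>(1) \<omega>] by simp
    show "\<kappa>\<^sub>1 \<omega> = \<kappa>\<^sub>2 \<omega>"
      by (rule measure_eqI_generator_eq[OF G(2,3), where A="\<lambda>_. topspace T"])
        (use eq G kernel_sets[OF \<kappa>(1) \<omega>] kernel_sets[OF \<kappa>(2) \<omega>] in auto)
  qed auto
  also have "\<dots> \<in> sets N"
  proof (rule sets.sets_Collect_countable_All'[OF _ G(1)])
    fix A assume A: "A \<in> G"
    have [measurable]: "(\<lambda>\<omega>. emeasure (\<kappa>\<^sub>1 \<omega>) A) \<in> borel_measurable N" "(\<lambda>\<omega>. emeasure (\<kappa>\<^sub>2 \<omega>) A) \<in> borel_measurable N"
      using kernel_emeasure_measurable \<kappa> GB[OF A] by blast+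
    show "{\<omega> \<in> space N. emeasure (\<kappa>\<^sub>1 \<omega>) A = emeasure (\<kappa>\<^sub>2 \<omega>) A} \<in> sets N"
      by measurable
  qed
  finally show ?thesis .
qed simp

text \<open>The defining integral equations of a conditional probability, written with nonnegative
  integrals. In this form both sides are measures in \<open>E\<close> as well as in the event, and the uniqueness
  theorem for measures applies.\<close>
lemma cond_prob_iff_nn_integral:
  assumes M: "prob_space M" and F: "subalgebra M F"
    and \<kappa>: "\<kappa> \<in> F \<rightarrow>\<^sub>M prob_algebra N" and A: "A \<in> sets N" and W: "W \<in> sets M"
  shows "(AE \<omega> in M. measure (\<kappa> \<omega>) A = real_cond_exp M F (indicator W) \<omega>) \<longleftrightarrow>
    (\<forall>E\<in>sets F. (\<integral>\<^sup>+\<omega>. emeasure (\<kappa> \<omega>) A * indicator E \<omega> \<partial>M) = emeasure M (E \<inter> W))"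
proof -
  interpret prob_space M by fact
  interpret finite_measure_subalgebra M F by unfold_locales (rule F)
  have space_F: "space F = space M" using F by (simp add: subalgebra_def)
  have mF: "(\<lambda>\<omega>. measure (\<kappa> \<omega>) A) \<in> borel_measurable F"
    using kernel_measure_measurable[OF \<kappa> A] .
  then have mM: "(\<lambda>\<omega>. measure (\<kappa> \<omega>) A) \<in> borel_measurable M"
    using measurable_from_subalg[OF F] by blast
  have le1: "measure (\<kappa> \<omega>) A \<le> 1" if "\<omega> \<in> space M" for \<omega>
    using kernel_sets(1)[OF \<kappa>] that space_F prob_space.prob_le_1 by metis
  have int_\<kappa>: "integrable M (\<lambda>\<omega>. measure (\<kappa> \<omega>) A)"
    by (rule integrable_const_bound[where B=1]) (use mM le1 in auto)
  have int_W: "integrable M (indicator W :: _ \<Rightarrow> real)"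
    using W by (intro integrable_const_bound[where B=1]) (auto simp: indicator_def)
  have FM: "E \<in> sets M" if "E \<in> sets F" for E
    using that F by (auto simp: subalgebra_def)
  have emeas: "(\<integral>\<^sup>+\<omega>. emeasure (\<kappa> \<omega>) A * indicator E \<omega> \<partial>M) = ennreal (\<integral>\<omega>\<in>E. measure (\<kappa> \<omega>) A \<partial>M)"
    if E: "E \<in> sets F" for E
  proof -
    have "(\<integral>\<^sup>+\<omega>. emeasure (\<kappa> \<omega>) A * indicator E \<omega> \<partial>M)
        = (\<integral>\<^sup>+\<omega>. ennreal (indicator E \<omega> * measure (\<kappa> \<omega>) A) \<partial>M)"
    proof (rule nn_integral_cong)
      fix \<omega> assume "\<omega> \<in> space M"
      then interpret \<kappa>: prob_space "\<kappa> \<omega>" using kernel_sets(1)[OF \<kappa>] space_F by simp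
      show "emeasure (\<kappa> \<omega>) A * indicator E \<omega> = ennreal (indicator E \<omega> * measure (\<kappa> \<omega>) A)"
        by (simp add: \<kappa>.emeasure_eq_measure indicator_def)
    qed
    also have "\<dots> = ennreal (\<integral>\<omega>. indicator E \<omega> * measure (\<kappa> \<omega>) A \<partial>M)"
      using FM[OF E] int_\<kappa> by (intro nn_integral_eq_integral integrable_mult_indicator[where 'b=real, simplified]) auto
    finally show ?thesis by (simp add: set_lebesgue_integral_def)
  qed
  have indW: "(\<integral>\<omega>\<in>E. indicator W \<omega> \<partial>M) = measure M (E \<inter> W)" if E: "E \<in> sets F" for E
  proof -
    have "(\<integral>\<omega>\<in>E. indicator W \<omega> \<partial>M) = (\<integral>\<omega>. (indicator (E \<inter> W) \<omega> :: real) \<partial>M)"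
      unfolding set_lebesgue_integral_def
      by (intro Bochner_Integration.integral_cong) (auto simp: indicator_def)
    then show ?thesis using FM[OF E] W by simp
  qed
  have nonneg: "0 \<le> (\<integral>\<omega>\<in>E. measure (\<kappa> \<omega>) A \<partial>M)" for E
    unfolding set_lebesgue_integral_def by (intro integral_nonneg_AE) auto
  have eq: "(\<integral>\<^sup>+\<omega>. emeasure (\<kappa> \<omega>) A * indicator E \<omega> \<partial>M) = emeasure M (E \<inter> W) \<longleftrightarrow>
      (\<integral>\<omega>\<in>E. measure (\<kappa> \<omega>) A \<partial>M) = (\<integral>\<omega>\<in>E. indicator W \<omega> \<partial>M)" if E: "E \<in> sets F" for E
    unfolding emeas[OF E] indW[OF E] emeasure_eq_measure using nonneg by simp
  show ?thesis
  proof
    assume ae: "AE \<omega> in M. measure (\<kappa> \<omega>) A = real_cond_exp M F (indicator W) \<omega>"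
    show "\<forall>E\<in>sets F. (\<integral>\<^sup>+\<omega>. emeasure (\<kappa> \<omega>) A * indicator E \<omega> \<partial>M) = emeasure M (E \<inter> W)"
    proof
      fix E assume E: "E \<in> sets F"
      have "(\<integral>\<omega>\<in>E. measure (\<kappa> \<omega>) A \<partial>M) = (\<integral>\<omega>\<in>E. real_cond_exp M F (indicator W) \<omega> \<partial>M)"
        using FM[OF E] ae mM by (intro set_lebesgue_integral_cong_AE) auto
      also have "\<dots> = (\<integral>\<omega>\<in>E. indicator W \<omega> \<partial>M)"
        by (rule real_cond_exp_intA[OF int_W E, symmetric])
      finally show "(\<integral>\<^sup>+\<omega>. emeasure (\<kappa> \<omega>) A * indicator E \<omega> \<partial>M) = emeasure M (E \<inter> W)"
        using eq[OF E] by simp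
    qed
  next
    assume "\<forall>E\<in>sets F. (\<integral>\<^sup>+\<omega>. emeasure (\<kappa> \<omega>) A * indicator E \<omega> \<partial>M) = emeasure M (E \<inter> W)"
    then have "AE \<omega> in M. real_cond_exp M F (indicator W) \<omega> = measure (\<kappa> \<omega>) A"
      using eq by (intro real_cond_exp_charact int_W int_\<kappa> mF) simp
    then show "AE \<omega> in M. measure (\<kappa> \<omega>) A = real_cond_exp M F (indicator W) \<omega>"
      by eventually_elim simp
  qed
qed

section \<open>The projective limit of conditional probabilities\<close>

locale conditional_projective_family = polish_projective_system D r X f + prob_space M
  for D :: "'i set" and r :: "('i \<times> 'i) set" and X :: "'i \<Rightarrow> 'x topology" and f :: "'i \<Rightarrow> 'i \<Rightarrow> 'x \<Rightarrow> 'x"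
    and M :: "'w measure" +
  fixes C :: "'i \<Rightarrow> 'w measure" and Y :: "'i \<Rightarrow> 'w \<Rightarrow> 'x" and P :: "'i \<Rightarrow> 'w \<Rightarrow> 'x measure"
  assumes filtration: "\<And>I J. (I, J) \<in> r \<Longrightarrow> subalgebra (C J) (C I)"
    and cond_prob: "\<And>I. I \<in> D \<Longrightarrow> regular_cond_prob M (C I) (borel_of (X I)) (Y I) (P I)"
    and projective: "projective_kernels M r X f P"
begin

abbreviation "CD \<equiv> limit_algebra M D C"

lemma C_sub: "I \<in> D \<Longrightarrow> subalgebra M (C I)"
  using cond_prob by (simp add: regular_cond_prob_def)

lemma C_subset: "I \<in> D \<Longrightarrow> sets (C I) \<subseteq> sets M" and space_C: "I \<in> D \<Longrightarrow> space (C I) = space M"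
  using C_sub by (auto simp: subalgebra_def)

lemma UN_C_Pow: "(\<Union>I\<in>D. sets (C I)) \<subseteq> Pow (space M)"
  using C_subset sets.sets_into_space by blast

lemma space_CD: "space CD = space M"
  using UN_C_Pow by (simp add: limit_algebra_def space_measure_of_conv)

lemma sets_CD: "sets CD = sigma_sets (space M) (\<Union>I\<in>D. sets (C I))"
  unfolding limit_algebra_def by (rule sets_measure_of[OF UN_C_Pow])

lemma CD_sub: "subalgebra M CD"
  unfolding subalgebra_def space_CD sets_CD
  using C_subset by (intro conjI refl sets.sigma_sets_subset) blast

lemma C_sub_CD: "I \<in> D \<Longrightarrow> subalgebra CD (C I)"
  unfolding subalgebra_def space_CD sets_CD using space_C by blast

lemma P_kernel: "I \<in> D \<Longrightarrow> P I \<in> C I \<rightarrow>\<^sub>M prob_algebra (borel_of (X I))"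
  using cond_prob by (simp add: regular_cond_prob_def)

lemma P_kernel_CD: "I \<in> D \<Longrightarrow> P I \<in> CD \<rightarrow>\<^sub>M prob_algebra (borel_of (X I))"
  using measurable_from_subalg[OF C_sub_CD P_kernel] .

lemma P_kernel_M: "I \<in> D \<Longrightarrow> P I \<in> M \<rightarrow>\<^sub>M prob_algebra (borel_of (X I))"
  using measurable_from_subalg[OF C_sub P_kernel] .

text \<open>Pairs are kept as single elements of \<open>r\<close>, so that the condition is one countable
  conjunction.\<close>
definition consistent :: "'w set" where
  "consistent = {\<omega> \<in> space M. \<forall>p\<in>r. distr (P (snd p) \<omega>) (borel_of (X (fst p))) (f (snd p) (fst p)) = P (fst p) \<omega>}"

lemma consistent_sets: "consistent \<in> sets CD"
  unfolding consistent_def space_CD[symmetric]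
proof (rule sets.sets_Collect_countable_All'[OF _ countable_rel])
  fix p assume "p \<in> r"
  then have p: "(fst p, snd p) \<in> r" by simp
  note D = index_rel[OF p]
  show "{\<omega> \<in> space CD. distr (P (snd p) \<omega>) (borel_of (X (fst p))) (f (snd p) (fst p)) = P (fst p) \<omega>} \<in> sets CD"
    using measurable_compose[OF P_kernel_CD[OF D(2)] measurable_distr_prob_space[OF f_measurable[OF p]]]
    by (rule kernels_eq_measurable[OF polish[OF D(1)] _ P_kernel_CD[OF D(1)]])
qed

lemma AE_consistent: "AE \<omega> in M. \<omega> \<in> consistent"
proof -
  have "AE \<omega> in M. \<forall>p\<in>r. distr (P (snd p) \<omega>) (borel_of (X (fst p))) (f (snd p) (fst p)) = P (fst p) \<omega>"
    using projective by (subst AE_ball_countable[OF countable_rel]) (auto simp: projective_kernels_def)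
  then show ?thesis using AE_space by eventually_elim (auto simp: consistent_def)
qed

text \<open>The limit measures can be chosen for each \<open>\<omega>\<close> separately: they are determined by their
  marginals, so the values on cylinders, and with them measurability, do not depend on the choice.
  Off the consistent set the kernel takes its value at one fixed consistent \<open>\<omega>0\<close>.\<close>
theorem proj_lim_kernel_exists:
  obtains PD where "PD \<in> CD \<rightarrow>\<^sub>M prob_algebra (borel_of XD)"
    "\<And>\<omega> I. \<omega> \<in> consistent \<Longrightarrow> I \<in> D \<Longrightarrow> distr (PD \<omega>) (borel_of (X I)) (\<lambda>x. x I) = P I \<omega>"
proof -
  have "\<exists>\<nu>. prob_space \<nu> \<and> sets \<nu> = sets (borel_of XD) \<and>
      (\<forall>I\<in>D. distr \<nu> (borel_of (X I)) (\<lambda>x. x I) = P I \<omega>)" if \<omega>: "\<omega> \<in> consistent" for \<omega>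
  proof -
    have "\<omega> \<in> space M" using \<omega> by (simp add: consistent_def)
    then have "prob_space (P I \<omega>)" "sets (P I \<omega>) = sets (borel_of (X I))" if "I \<in> D" for I
      using kernel_sets[OF P_kernel_M[OF that]] by auto
    moreover have "distr (P J \<omega>) (borel_of (X I)) (f J I) = P I \<omega>" if "(I, J) \<in> r" for I J
      using \<omega> that by (force simp: consistent_def)
    ultimately show ?thesis
      using limit_measure_exists[of "\<lambda>I. P I \<omega>"] by metis
  qed
  then obtain \<nu> where \<nu>: "\<And>\<omega>. \<omega> \<in> consistent \<Longrightarrow> prob_space (\<nu> \<omega>)"
    "\<And>\<omega>. \<omega> \<in> consistent \<Longrightarrow> sets (\<nu> \<omega>) = sets (borel_of XD)"
    "\<And>\<omega> I. \<omega> \<in> consistent \<Longrightarrow> I \<in> D \<Longrightarrow> distr (\<nu> \<omega>) (borel_of (X I)) (\<lambda>x. x I) = P I \<omega>"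
    by metis
  have "consistent \<noteq> {}" using AE_consistent AE_False by auto
  then obtain \<omega>0 where \<omega>0: "\<omega>0 \<in> consistent" by blast
  define PD where "PD \<omega> = \<nu> (if \<omega> \<in> consistent then \<omega> else \<omega>0)" for \<omega>
  have "PD \<in> CD \<rightarrow>\<^sub>M prob_algebra (borel_of XD)"
  proof (rule measurable_prob_algebra_generated[OF sets_XD Int_stable_cylinders cylinders_subset])
    show "prob_space (PD \<omega>)" "sets (PD \<omega>) = sets (borel_of XD)" for \<omega>
      using \<nu> \<omega>0 by (auto simp: PD_def)
    fix B assume "B \<in> cylinders"
    then obtain I A where I: "I \<in> D" and A: "A \<in> sets (borel_of (X I))" and B: "B = {x \<in> L. x I \<in> A}"
      unfolding cylinders_def by blast
    have "emeasure (PD \<omega>) B = (if \<omega> \<in> consistent then emeasure (P I \<omega>) A else emeasure (P I \<omega>0) A)" for \<omega>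
      using marginal_emeasure[OF I A \<nu>(2)] \<nu>(3)[OF _ I] \<omega>0 by (auto simp: PD_def B)
    then show "(\<lambda>\<omega>. emeasure (PD \<omega>) B) \<in> borel_measurable CD"
      using kernel_emeasure_measurable[OF P_kernel_CD[OF I] A] consistent_sets
      by (simp add: measurable_If_set sets.Int_space_eq2)
  qed
  then show ?thesis using that[of PD] \<nu>(3) by (auto simp: PD_def)
qed

lemma proj_lim_kernel_AE:
  assumes "proj_lim_kernel M D r X f C P PD"
  shows "AE \<omega> in M. \<forall>I\<in>D. distr (PD \<omega>) (borel_of (X I)) (\<lambda>x. x I) = P I \<omega>"
  using assms by (subst AE_ball_countable[OF countable_index]) (auto simp: proj_lim_kernel_def)

text \<open>Conditioning on the larger \<open>\<sigma>\<close>-algebra \<open>C\<^sub>D\<close> does not change the conditional distribution of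
  the coordinate \<open>I\<close>. For an event of \<open>C J\<close> with \<open>J\<close> above \<open>I\<close> the claim follows from the
  conditional distribution of \<open>Y J\<close>, because \<open>Y I\<close> is almost surely \<open>f J I (Y J)\<close>; this is where the
  random element \<open>Z\<close> of the limit is needed. Both sides are finite measures in \<open>E\<close>, and
  these events generate \<open>C\<^sub>D\<close>.\<close>
lemma integral_kernel_over_CD:
  assumes Z: "Z \<in> M \<rightarrow>\<^sub>M borel_of XD" and ZY: "\<And>I. I \<in> D \<Longrightarrow> AE \<omega> in M. Z \<omega> I = Y I \<omega>"
    and I: "I \<in> D" and A: "A \<in> sets (borel_of (X I))" and E: "E \<in> sets CD"
  shows "(\<integral>\<^sup>+\<omega>. emeasure (P I \<omega>) A * indicator E \<omega> \<partial>M) = emeasure M (E \<inter> (Z -` {x \<in> L. x I \<in> A} \<inter> space M))"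
proof -
  let ?B = "{x \<in> L. x I \<in> A}"
  let ?W = "Z -` ?B \<inter> space M"
  have ZL: "Z \<omega> \<in> L" if "\<omega> \<in> space M" for \<omega>
    using measurable_space[OF Z that] by (simp add: topspace_XD)
  have W: "?W \<in> sets M" by (rule measurable_sets[OF Z cylinder_sets[OF I A]])
  have Pm: "(\<lambda>\<omega>. emeasure (P I \<omega>) A) \<in> borel_measurable M"
    by (rule kernel_emeasure_measurable[OF P_kernel_M[OF I] A])
  have le1: "emeasure (P I \<omega>) A \<le> 1" if "\<omega> \<in> space M" for \<omega>
    using kernel_sets(1)[OF P_kernel_M[OF I] that] prob_space.emeasure_le_1 by blast
  define G where "G = (\<Union>J\<in>{J. (I, J) \<in> r}. sets (C J))"
  have on_G: "(\<integral>\<^sup>+\<omega>. emeasure (P I \<omega>) A * indicator E \<omega> \<partial>M) = emeasure M (E \<inter> ?W)" if E: "E \<in> G" for E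
  proof -
    obtain J where IJ: "(I, J) \<in> r" and EJ: "E \<in> sets (C J)" using E unfolding G_def by blast
    have J: "J \<in> D" using index_rel[OF IJ] by simp
    let ?A = "f J I -` A \<inter> space (borel_of (X J))"
    have A': "?A \<in> sets (borel_of (X J))" by (rule measurable_sets[OF f_measurable[OF IJ] A])
    have YJ: "Y J \<in> M \<rightarrow>\<^sub>M borel_of (X J)" using cond_prob[OF J] by (simp add: regular_cond_prob_def)
    have EM: "E \<in> sets M" using EJ C_subset[OF J] by blast
    have "AE \<omega> in M. distr (P J \<omega>) (borel_of (X I)) (f J I) = P I \<omega>"
      using projective IJ by (simp add: projective_kernels_def)
    then have "AE \<omega> in M. emeasure (P I \<omega>) A = emeasure (P J \<omega>) ?A"
      using AE_space
    proof eventually_elim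
      fix \<omega> assume d: "distr (P J \<omega>) (borel_of (X I)) (f J I) = P I \<omega>" and \<omega>: "\<omega> \<in> space M"
      have s: "sets (P J \<omega>) = sets (borel_of (X J))" using kernel_sets(2)[OF P_kernel_M[OF J] \<omega>] .
      have "f J I \<in> P J \<omega> \<rightarrow>\<^sub>M borel_of (X I)"
        using f_measurable[OF IJ] measurable_cong_sets[OF s refl] by blast
      from emeasure_distr[OF this A] show "emeasure (P I \<omega>) A = emeasure (P J \<omega>) ?A"
        using sets_eq_imp_space_eq[OF s] by (simp add: d)
    qed
    then have "(\<integral>\<^sup>+\<omega>. emeasure (P I \<omega>) A * indicator E \<omega> \<partial>M) = (\<integral>\<^sup>+\<omega>. emeasure (P J \<omega>) ?A * indicator E \<omega> \<partial>M)"
      by (intro nn_integral_cong_AE) auto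
    also have "\<dots> = emeasure M (E \<inter> (Y J -` ?A \<inter> space M))"
    proof -
      have "AE \<omega> in M. measure (P J \<omega>) ?A = real_cond_exp M (C J) (indicator (Y J -` ?A \<inter> space M)) \<omega>"
        using cond_prob[OF J] A' unfolding regular_cond_prob_def by blast
      then show ?thesis
        using cond_prob_iff_nn_integral[OF prob_space_axioms C_sub[OF J] P_kernel[OF J] A' measurable_sets[OF YJ A']] EJ
        by blast
    qed
    also have "\<dots> = emeasure M (E \<inter> ?W)"
    proof (rule emeasure_eq_AE)
      show "AE \<omega> in M. (\<omega> \<in> E \<inter> (Y J -` ?A \<inter> space M)) = (\<omega> \<in> E \<inter> ?W)"
        using ZY[OF J] AE_space
      proof eventually_elim
        fix \<omega> assume z: "Z \<omega> J = Y J \<omega>" and \<omega>: "\<omega> \<in> space M"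
        have "f J I (Y J \<omega>) = Z \<omega> I" using coord_rel[OF ZL[OF \<omega>] IJ] z by simp
        moreover have "Y J \<omega> \<in> topspace (X J)" using coord_topspace[OF ZL[OF \<omega>] J] z by simp
        ultimately show "(\<omega> \<in> E \<inter> (Y J -` ?A \<inter> space M)) = (\<omega> \<in> E \<inter> ?W)"
          using ZL[OF \<omega>] \<omega> by auto
      qed
    qed (use EM W measurable_sets[OF YJ A'] in auto)
    finally show ?thesis .
  qed
  define \<mu>1 where "\<mu>1 = density M (\<lambda>\<omega>. emeasure (P I \<omega>) A)"
  define \<mu>2 where "\<mu>2 = density M (indicator ?W)"
  have sub: "subalgebra \<mu>1 CD" "subalgebra \<mu>2 CD"
    using CD_sub by (auto simp: subalgebra_def \<mu>1_def \<mu>2_def)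
  have em1: "emeasure \<mu>1 E = (\<integral>\<^sup>+\<omega>. emeasure (P I \<omega>) A * indicator E \<omega> \<partial>M)" if "E \<in> sets M" for E
    unfolding \<mu>1_def by (rule emeasure_density[OF Pm that])
  have em2: "emeasure \<mu>2 E = emeasure M (E \<inter> ?W)" if "E \<in> sets M" for E
    unfolding \<mu>2_def using W that by (subst emeasure_density) (auto simp: indicator_inter_arith[symmetric] Int_commute)
  have GC: "G \<subseteq> sets CD"
    unfolding G_def using C_sub_CD[OF index_rel(2)] by (auto simp: subalgebra_def)
  have CM: "sets CD \<subseteq> sets M" using CD_sub by (simp add: subalgebra_def)
  have "restr_to_subalg \<mu>1 CD = restr_to_subalg \<mu>2 CD"
  proof (rule measure_eqI_generator_eq[where \<Omega>="space M" and E=G and A="\<lambda>_. space M"])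
    show "Int_stable G"
    proof (rule Int_stableI)
      fix a b assume "a \<in> G" "b \<in> G"
      then obtain J K where J: "(I, J) \<in> r" "a \<in> sets (C J)" and K: "(I, K) \<in> r" "b \<in> sets (C K)"
        unfolding G_def by blast
      obtain H where H: "(J, H) \<in> r" "(K, H) \<in> r"
        using directed[OF index_rel(2)[OF J(1)] index_rel(2)[OF K(1)]] by blast
      have "a \<in> sets (C H)" "b \<in> sets (C H)"
        using filtration[OF H(1)] filtration[OF H(2)] J K by (auto simp: subalgebra_def)
      then show "a \<inter> b \<in> G" unfolding G_def using rel_trans[OF J(1) H(1)] by auto
    qed
    show "G \<subseteq> Pow (space M)" using GC CM sets.sets_into_space by blast
    have gen: "sigma_sets (space M) G = sets CD"
    proof
      show "sigma_sets (space M) G \<subseteq> sets CD"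
        using sets.sigma_sets_subset[OF GC] by (simp add: space_CD)
      have "(\<Union>J\<in>D. sets (C J)) \<subseteq> G"
      proof
        fix a assume "a \<in> (\<Union>J\<in>D. sets (C J))"
        then obtain J where J: "J \<in> D" "a \<in> sets (C J)" by blast
        obtain H where H: "(I, H) \<in> r" "(J, H) \<in> r" using directed[OF I J(1)] by blast
        then show "a \<in> G" unfolding G_def using filtration[OF H(2)] J(2) by (auto simp: subalgebra_def)
      qed
      then show "sets CD \<subseteq> sigma_sets (space M) G"
        unfolding sets_CD by (rule sigma_sets_mono')
    qed
    show "sets (restr_to_subalg \<mu>1 CD) = sigma_sets (space M) G"
      "sets (restr_to_subalg \<mu>2 CD) = sigma_sets (space M) G"
      using sets_restr_to_subalg sub gen by auto
    show "emeasure (restr_to_subalg \<mu>1 CD) a = emeasure (restr_to_subalg \<mu>2 CD) a" if "a \<in> G" for a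
    proof -
      have a: "a \<in> sets CD" "a \<in> sets M" using that GC CM by auto
      show ?thesis
        unfolding emeasure_restr_to_subalg[OF sub(1) a(1)] emeasure_restr_to_subalg[OF sub(2) a(1)]
          em1[OF a(2)] em2[OF a(2)] by (rule on_G[OF that])
    qed
    show "range (\<lambda>_. space M) \<subseteq> G"
      unfolding G_def using rel_refl[OF I] space_C[OF I] sets.top[of "C I"] by auto
    show "(\<Union>i::nat. space M) = space M" by simp
    have "emeasure \<mu>1 (space M) \<le> (\<integral>\<^sup>+\<omega>. 1 \<partial>M)"
      unfolding em1[OF sets.top] using le1 by (intro nn_integral_mono) (simp add: indicator_def)
    then have "emeasure \<mu>1 (space M) < \<infinity>"
      by (simp add: emeasure_space_1 order_le_less_trans)
    then show "emeasure (restr_to_subalg \<mu>1 CD) (space M) \<noteq> \<infinity>"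
      using emeasure_restr_to_subalg[OF sub(1), of "space M"] sets.top[of CD] space_CD by simp
  qed
  then have "emeasure \<mu>1 E = emeasure \<mu>2 E"
    using emeasure_restr_to_subalg[OF sub(1) E] emeasure_restr_to_subalg[OF sub(2) E] by simp
  then show ?thesis using em1[of E] em2[of E] E CM by auto
qed

text \<open>For a fixed event \<open>E\<close> both sides of the integral equation are measures in \<open>B\<close>: the mixture of the
  kernel over \<open>E\<close> and the distribution of \<open>Z\<close> on \<open>E\<close>. They agree on cylinders by the previous
  lemma.\<close>
theorem proj_lim_kernel_cond_prob:
  assumes PD: "proj_lim_kernel M D r X f C P PD"
    and Z: "Z \<in> M \<rightarrow>\<^sub>M borel_of XD" and ZY: "\<And>I. I \<in> D \<Longrightarrow> AE \<omega> in M. Z \<omega> I = Y I \<omega>"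
    and B: "B \<in> sets (borel_of XD)"
  shows "AE \<omega> in M. measure (PD \<omega>) B = real_cond_exp M CD (indicator (Z -` B \<inter> space M)) \<omega>"
proof -
  have kPD: "PD \<in> CD \<rightarrow>\<^sub>M prob_algebra (borel_of XD)"
    using PD by (simp add: proj_lim_kernel_def)
  have kPDM: "PD \<in> M \<rightarrow>\<^sub>M prob_algebra (borel_of XD)"
    by (rule measurable_from_subalg[OF CD_sub kPD])
  have W: "Z -` B \<inter> space M \<in> sets M" by (rule measurable_sets[OF Z B])
  have "(\<integral>\<^sup>+\<omega>. emeasure (PD \<omega>) B * indicator E \<omega> \<partial>M) = emeasure M (E \<inter> (Z -` B \<inter> space M))"
    if E: "E \<in> sets CD" for E
  proof -
    have EM: "E \<in> sets M" using E CD_sub by (auto simp: subalgebra_def)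
    define \<rho> where "\<rho> = density M (indicator E)"
    have sets_\<rho>: "sets \<rho> = sets M" by (simp add: \<rho>_def)
    have k\<rho>: "PD \<in> \<rho> \<rightarrow>\<^sub>M subprob_algebra (borel_of XD)"
      using measurable_prob_algebraD[OF kPDM] measurable_cong_sets[OF sets_\<rho> refl] by blast
    have Z\<rho>: "Z \<in> \<rho> \<rightarrow>\<^sub>M borel_of XD"
      using Z measurable_cong_sets[OF sets_\<rho> refl] by blast
    have ne: "space \<rho> \<noteq> {}" using not_empty by (simp add: \<rho>_def)
    have em1: "emeasure (\<rho> \<bind> PD) B' = (\<integral>\<^sup>+\<omega>. emeasure (PD \<omega>) B' * indicator E \<omega> \<partial>M)"
      if "B' \<in> sets (borel_of XD)" for B'
    proof -
      have "emeasure (\<rho> \<bind> PD) B' = (\<integral>\<^sup>+\<omega>. emeasure (PD \<omega>) B' \<partial>\<rho>)"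
        by (rule emeasure_bind[OF ne k\<rho> that])
      also have "\<dots> = (\<integral>\<^sup>+\<omega>. indicator E \<omega> * emeasure (PD \<omega>) B' \<partial>M)"
        unfolding \<rho>_def using EM kernel_emeasure_measurable[OF kPDM that]
        by (intro nn_integral_density) auto
      finally show ?thesis by (simp add: mult.commute)
    qed
    have em2: "emeasure (distr \<rho> (borel_of XD) Z) B' = emeasure M (E \<inter> (Z -` B' \<inter> space M))"
      if "B' \<in> sets (borel_of XD)" for B'
    proof -
      have "emeasure (distr \<rho> (borel_of XD) Z) B' = emeasure \<rho> (Z -` B' \<inter> space M)"
        using emeasure_distr[OF Z\<rho> that] by (simp add: \<rho>_def)
      also have "\<dots> = emeasure M (E \<inter> (Z -` B' \<inter> space M))"
        unfolding \<rho>_def using EM measurable_sets[OF Z that]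
        by (subst emeasure_density) (auto simp: indicator_inter_arith[symmetric])
      finally show ?thesis .
    qed
    have "\<rho> \<bind> PD = distr \<rho> (borel_of XD) Z"
    proof (rule measure_eqI_generator_eq[OF Int_stable_cylinders cylinders_subset, where A="\<lambda>_. L"])
      have "sets (\<rho> \<bind> PD) = sets (borel_of XD)"
        using sets_bind[of \<rho> PD "borel_of XD"] sets_kernel[OF k\<rho>] ne by blast
      then show "sets (\<rho> \<bind> PD) = sigma_sets L cylinders" using sets_XD by simp
      show "sets (distr \<rho> (borel_of XD) Z) = sigma_sets L cylinders" using sets_XD by simp
      show "range (\<lambda>_. L) \<subseteq> cylinders" "(\<Union>i::nat. L) = L" using L_in_cylinders by auto
      show cyl: "emeasure (\<rho> \<bind> PD) B' = emeasure (distr \<rho> (borel_of XD) Z) B'" if "B' \<in> cylinders" for B'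
      proof -
        obtain I A where I: "I \<in> D" and A: "A \<in> sets (borel_of (X I))" and B': "B' = {x \<in> L. x I \<in> A}"
          using \<open>B' \<in> cylinders\<close> unfolding cylinders_def by blast
        have Bs: "B' \<in> sets (borel_of XD)" unfolding B' by (rule cylinder_sets[OF I A])
        have "AE \<omega> in M. distr (PD \<omega>) (borel_of (X I)) (\<lambda>x. x I) = P I \<omega>"
          using PD I by (simp add: proj_lim_kernel_def)
        then have "AE \<omega> in M. emeasure (PD \<omega>) B' = emeasure (P I \<omega>) A"
          using AE_space
        proof eventually_elim
          fix \<omega> assume d: "distr (PD \<omega>) (borel_of (X I)) (\<lambda>x. x I) = P I \<omega>" and "\<omega> \<in> space M"
          then have "sets (PD \<omega>) = sets (borel_of XD)" using kernel_sets(2)[OF kPDM] by blast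
          from marginal_emeasure[OF I A this] show "emeasure (PD \<omega>) B' = emeasure (P I \<omega>) A"
            by (simp add: d B')
        qed
        then have "emeasure (\<rho> \<bind> PD) B' = (\<integral>\<^sup>+\<omega>. emeasure (P I \<omega>) A * indicator E \<omega> \<partial>M)"
          unfolding em1[OF Bs] by (intro nn_integral_cong_AE) auto
        also have "\<dots> = emeasure M (E \<inter> (Z -` B' \<inter> space M))"
          unfolding B' by (rule integral_kernel_over_CD[OF Z ZY I A E])
        finally show ?thesis using em2[OF Bs] by simp
      qed
      have "emeasure (distr \<rho> (borel_of XD) Z) L \<le> emeasure M (space M)"
        using em2[OF sets.top] by (auto simp: topspace_XD intro!: emeasure_mono)
      then show "emeasure (\<rho> \<bind> PD) L \<noteq> \<infinity>"
        using cyl[OF L_in_cylinders] by (auto simp: emeasure_space_1 top_unique)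
    qed
    then show ?thesis using em1[OF B] em2[OF B] by simp
  qed
  then show ?thesis
    using cond_prob_iff_nn_integral[OF prob_space_axioms CD_sub kPD B W] by blast
qed

end

section \<open>Conditional probabilities on the Hausdorff space\<close>

theorem corollary1:
  fixes M :: "'w measure"
    and D :: "'i set" and r :: "('i \<times> 'i) set"
    and X :: "'i \<Rightarrow> 'x topology" and f :: "'i \<Rightarrow> 'i \<Rightarrow> 'x \<Rightarrow> 'x"
    and T :: "'y topology" and \<phi> :: "'y \<Rightarrow> 'i \<Rightarrow> 'x"
    and C :: "'i \<Rightarrow> 'w measure" and Y :: "'i \<Rightarrow> 'w \<Rightarrow> 'x" and P :: "'i \<Rightarrow> 'w \<Rightarrow> 'x measure"
  defines "XD \<equiv> proj_lim D r X f"
    and "CD \<equiv> limit_algebra M D C"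
    and "\<Omega>t \<equiv> tight_points M D P T \<phi>"
  defines "G \<equiv> vimage_algebra (topspace T) \<phi> (borel_of XD)"
    and "CDt \<equiv> restrict_space CD \<Omega>t"
  assumes "prob_space M"
    and "polish_projective_system D r X f"
    and "Hausdorff_space T"
    and "continuous_map T XD \<phi>"
    and "inj_on \<phi> (topspace T)"
    and "\<phi> ` topspace T \<in> sets (borel_of XD)"
    and "\<And>I J. (I, J) \<in> r \<Longrightarrow> subalgebra (C J) (C I)"
    and "\<And>I. I \<in> D \<Longrightarrow> regular_cond_prob M (C I) (borel_of (X I)) (Y I) (P I)"
    and "projective_kernels M r X f P"
  shows "\<exists>Pt.
      prob_kernel CDt (borel_of T) G Pt \<and>
      (\<forall>I\<in>D. AE \<omega> in M. \<omega> \<in> \<Omega>t \<longrightarrow> distr (Pt \<omega>) (borel_of (X I)) (\<lambda>x. \<phi> x I) = P I \<omega>) \<and>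
      (\<forall>Q. prob_kernel CDt (borel_of T) G Q \<and>
           (\<forall>I\<in>D. AE \<omega> in M. \<omega> \<in> \<Omega>t \<longrightarrow> distr (Q \<omega>) (borel_of (X I)) (\<lambda>x. \<phi> x I) = P I \<omega>)
         \<longrightarrow> (AE \<omega> in M. \<omega> \<in> \<Omega>t \<longrightarrow> Q \<omega> = Pt \<omega>)) \<and>
      (\<forall>\<omega>\<in>\<Omega>t. radon_measure T (Pt \<omega>)) \<and>
      (\<exists>PD. proj_lim_kernel M D r X f C P PD) \<and>
      (\<forall>PD. proj_lim_kernel M D r X f C P PD \<longrightarrow>
         (AE \<omega> in M. \<omega> \<in> \<Omega>t \<longrightarrow>
            is_pullback (topspace T) \<phi> (PD \<omega>) (restr_to_subalg (Pt \<omega>) G))) \<and>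
      (\<forall>Z \<in> M \<rightarrow>\<^sub>M borel_of XD. (\<forall>I\<in>D. AE \<omega> in M. Z \<omega> I = Y I \<omega>) \<longrightarrow>
         (\<forall>A\<in>sets G. AE \<omega> in M. \<omega> \<in> \<Omega>t \<longrightarrow>
            measure (Pt \<omega>) A = real_cond_exp M CD (indicator (Z -` (\<phi> ` A) \<inter> space M)) \<omega>))"
proof -
  interpret F: conditional_projective_family D r X f M C Y P
    using assms(6,7,12-14)
    by (intro conditional_projective_family.intro conditional_projective_family_axioms.intro)
  note cont = assms(9)[unfolded XD_def]
  have top_XD: "topspace XD = F.L" unfolding XD_def by (rule F.topspace_XD)
  have \<phi>_meas: "\<phi> \<in> borel_of T \<rightarrow>\<^sub>M borel_of XD"
    using assms(9) by (rule continuous_map_borel_of_measurable)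
  have \<Omega>t_sub: "\<Omega>t \<subseteq> space M" by (auto simp: \<Omega>t_def tight_points_def)
  have space_CDt: "space CDt = \<Omega>t"
    using \<Omega>t_sub by (auto simp: CDt_def CD_def space_restrict_space F.space_CD)
  have sets_G: "sets G = {\<phi> -` B \<inter> topspace T | B. B \<in> sets (borel_of XD)}"
    unfolding G_def using measurable_space[OF \<phi>_meas] by (subst sets_vimage_algebra2) auto
  have space_G: "space G = topspace T" by (simp add: G_def)
  have G_borel: "sets G \<subseteq> sets (borel_of T)"
    using measurable_sets[OF \<phi>_meas] by (auto simp: sets_G)
  obtain PD where PD: "PD \<in> CD \<rightarrow>\<^sub>M prob_algebra (borel_of XD)"
    and PD_marg: "\<And>\<omega> I. \<omega> \<in> F.consistent \<Longrightarrow> I \<in> D \<Longrightarrow> distr (PD \<omega>) (borel_of (X I)) (\<lambda>x. x I) = P I \<omega>"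
    using F.proj_lim_kernel_exists unfolding XD_def CD_def by metis
  have PD_lim: "proj_lim_kernel M D r X f C P PD"
    unfolding proj_lim_kernel_def
  proof (intro conjI ballI)
    show "PD \<in> limit_algebra M D C \<rightarrow>\<^sub>M prob_algebra (borel_of (proj_lim D r X f))"
      using PD by (simp add: CD_def XD_def)
    fix I assume "I \<in> D"
    then show "AE \<omega> in M. distr (PD \<omega>) (borel_of (X I)) (\<lambda>x. x I) = P I \<omega>"
      using F.AE_consistent PD_marg by auto
  qed
  have PD_prob: "prob_space (PD \<omega>)" "sets (PD \<omega>) = sets (borel_of XD)" if "\<omega> \<in> space M" for \<omega>
    using kernel_sets[OF PD] that F.space_CD by (auto simp: CD_def)

  have tight: "\<exists>K. compactin T K \<and> (\<forall>I\<in>D. measure (P I \<omega>) ((\<lambda>x. \<phi> x I) ` K) > 1 - \<epsilon>)"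
    if "\<omega> \<in> \<Omega>t" "\<epsilon> > 0" for \<omega> \<epsilon>
    using that by (auto simp: \<Omega>t_def tight_points_def)
  have T_ne: "topspace T \<noteq> {}" if \<omega>: "\<omega> \<in> \<Omega>t" for \<omega>
  proof
    assume "topspace T = {}"
    moreover obtain K where "compactin T K" and K: "\<forall>I\<in>D. measure (P I \<omega>) ((\<lambda>x. \<phi> x I) ` K) > 1 - 1"
      using tight[OF \<omega>, of 1] by auto
    ultimately have "K = {}" by (auto simp: compactin_def)
    then show False using K F.index_nonempty by auto
  qed
  define lift where "lift \<omega> \<mu> \<longleftrightarrow> prob_space \<mu> \<and> sets \<mu> = sets (borel_of T) \<and> distr \<mu> (borel_of XD) \<phi> = PD \<omega> \<and>
      radon_measure T \<mu> \<and>
      (\<forall>\<mu>'. sets \<mu>' = sets (borel_of T) \<longrightarrow> distr \<mu>' (borel_of XD) \<phi> = PD \<omega> \<longrightarrow> \<mu>' = \<mu>)" for \<omega> \<mu>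
  have lift_ex: "\<exists>\<mu>. lift \<omega> \<mu>" if \<omega>: "\<omega> \<in> \<Omega>t" "\<omega> \<in> F.consistent" for \<omega>
  proof -
    have "\<omega> \<in> space M" using \<omega>(1) \<Omega>t_sub by blast
    note PDp = PD_prob[OF this, unfolded XD_def]
    have t: "\<exists>K. compactin T K \<and>
      (\<forall>I\<in>D. measure (distr (PD \<omega>) (borel_of (X I)) (\<lambda>x. x I)) ((\<lambda>t. \<phi> t I) ` K) > 1 - \<epsilon>)"
      if "\<epsilon> > 0" for \<epsilon>
      using tight[OF \<omega>(1) that] PD_marg[OF \<omega>(2)] by simp
    obtain \<mu> where "prob_space \<mu>" "sets \<mu> = sets (borel_of T)" "distr \<mu> (borel_of (proj_lim D r X f)) \<phi> = PD \<omega>"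
      "radon_measure T \<mu>"
      "\<And>\<mu>'. sets \<mu>' = sets (borel_of T) \<Longrightarrow> distr \<mu>' (borel_of (proj_lim D r X f)) \<phi> = PD \<omega> \<Longrightarrow> \<mu>' = \<mu>"
      by (rule F.tight_measure_lift[OF cont assms(8,10) PDp t]) blast+
    then show ?thesis unfolding lift_def XD_def by blast
  qed
  define t0 where "t0 = (SOME t. t \<in> topspace T)"
  have t0: "t0 \<in> topspace T" if "\<omega> \<in> \<Omega>t" for \<omega>
    unfolding t0_def using T_ne[OF that] by (rule some_in_eq[THEN iffD2])
  \<comment> \<open>The exceptional null set belongs to \<open>C\<^sub>D\<close>, so a constant value there keeps the kernel
      measurable; a point mass keeps it Radon.\<close>
  define Pt where "Pt \<omega> = (if \<omega> \<in> F.consistent then SOME \<mu>. lift \<omega> \<mu> else return (borel_of T) t0)" for \<omega>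
  have Pt_lift: "lift \<omega> (Pt \<omega>)" if "\<omega> \<in> \<Omega>t" "\<omega> \<in> F.consistent" for \<omega>
    using someI_ex[OF lift_ex[OF that]] that(2) by (simp add: Pt_def)
  have Pt_prob: "prob_space (Pt \<omega>)" "sets (Pt \<omega>) = sets (borel_of T)" if "\<omega> \<in> \<Omega>t" for \<omega>
  proof -
    have "prob_space (return (borel_of T) t0)" using t0[OF that] by (intro prob_space_return) simp
    then have "prob_space (Pt \<omega>) \<and> sets (Pt \<omega>) = sets (borel_of T)"
      using Pt_lift[OF that] by (cases "\<omega> \<in> F.consistent") (simp_all add: Pt_def lift_def)
    then show "prob_space (Pt \<omega>)" "sets (Pt \<omega>) = sets (borel_of T)" by simp_all
  qed
  have Pt_meas: "\<phi> \<in> Pt \<omega> \<rightarrow>\<^sub>M borel_of XD" if "\<omega> \<in> \<Omega>t" for \<omega>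
    using \<phi>_meas measurable_cong_sets[OF Pt_prob(2)[OF that] refl] by blast
  have Pt_PD: "emeasure (Pt \<omega>) (\<phi> -` B \<inter> topspace T) = emeasure (PD \<omega>) B"
    if \<omega>: "\<omega> \<in> \<Omega>t" "\<omega> \<in> F.consistent" and B: "B \<in> sets (borel_of XD)" for \<omega> B
    using emeasure_distr[OF Pt_meas[OF \<omega>(1)] B] Pt_lift[OF \<omega>]
      sets_eq_imp_space_eq[OF Pt_prob(2)[OF \<omega>(1)]] by (simp add: lift_def)
  have marg: "distr \<mu> (borel_of (X I)) (\<lambda>x. \<phi> x I) = distr (distr \<mu> (borel_of XD) \<phi>) (borel_of (X I)) (\<lambda>x. x I)"
    if "sets \<mu> = sets (borel_of T)" "I \<in> D" for \<mu> I
  proof -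
    have "\<phi> \<in> \<mu> \<rightarrow>\<^sub>M borel_of XD" using \<phi>_meas measurable_cong_sets[OF that(1) refl] by blast
    from distr_distr[OF F.coord_measurable[OF that(2), folded XD_def] this] show ?thesis
      by (simp add: comp_def)
  qed
  show ?thesis
  proof (intro exI[of _ Pt] conjI)
    show "prob_kernel CDt (borel_of T) G Pt"
      unfolding prob_kernel_def space_CDt
    proof (intro conjI ballI)
      fix A assume A: "A \<in> sets G"
      then obtain B where B: "B \<in> sets (borel_of XD)" "A = \<phi> -` B \<inter> topspace T" by (auto simp: sets_G)
      have "(\<lambda>\<omega>. if \<omega> \<in> F.consistent then measure (PD \<omega>) B else indicator A t0) \<in> borel_measurable CD"
        using kernel_measure_measurable[OF PD B(1)] F.consistent_sets
        by (intro measurable_If_set measurable_const) (auto simp: CD_def sets.Int_space_eq2)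
      then have "(\<lambda>\<omega>. if \<omega> \<in> F.consistent then measure (PD \<omega>) B else indicator A t0) \<in> borel_measurable CDt"
        unfolding CDt_def by (rule measurable_restrict_space1)
      then show "(\<lambda>\<omega>. measure (Pt \<omega>) A) \<in> borel_measurable CDt"
      proof (rule measurable_cong[THEN iffD1, rotated])
        fix \<omega> assume "\<omega> \<in> space CDt"
        then have \<omega>: "\<omega> \<in> \<Omega>t" by (simp add: space_CDt)
        show "(if \<omega> \<in> F.consistent then measure (PD \<omega>) B else indicator A t0) = measure (Pt \<omega>) A"
        proof (cases "\<omega> \<in> F.consistent")
          case True
          then show ?thesis using Pt_PD[OF \<omega> True B(1)] by (simp add: B(2) measure_def)
        next
          case False
          have "A \<in> sets (borel_of T)" using A G_borel by blast
          then show ?thesis using False by (simp add: Pt_def measure_return)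
        qed
      qed
    qed (use Pt_prob in auto)
    show "\<forall>I\<in>D. AE \<omega> in M. \<omega> \<in> \<Omega>t \<longrightarrow> distr (Pt \<omega>) (borel_of (X I)) (\<lambda>x. \<phi> x I) = P I \<omega>"
    proof
      fix I assume I: "I \<in> D"
      show "AE \<omega> in M. \<omega> \<in> \<Omega>t \<longrightarrow> distr (Pt \<omega>) (borel_of (X I)) (\<lambda>x. \<phi> x I) = P I \<omega>"
        using F.AE_consistent
      proof eventually_elim
        fix \<omega> assume c: "\<omega> \<in> F.consistent"
        show "\<omega> \<in> \<Omega>t \<longrightarrow> distr (Pt \<omega>) (borel_of (X I)) (\<lambda>x. \<phi> x I) = P I \<omega>"
          using marg[OF Pt_prob(2) I] Pt_lift[OF _ c] PD_marg[OF c I] by (simp add: lift_def)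
      qed
    qed
    show "\<forall>Q. prob_kernel CDt (borel_of T) G Q \<and>
           (\<forall>I\<in>D. AE \<omega> in M. \<omega> \<in> \<Omega>t \<longrightarrow> distr (Q \<omega>) (borel_of (X I)) (\<lambda>x. \<phi> x I) = P I \<omega>)
         \<longrightarrow> (AE \<omega> in M. \<omega> \<in> \<Omega>t \<longrightarrow> Q \<omega> = Pt \<omega>)"
    proof (intro allI impI, elim conjE)
      fix Q assume Q: "prob_kernel CDt (borel_of T) G Q"
        and Qm: "\<forall>I\<in>D. AE \<omega> in M. \<omega> \<in> \<Omega>t \<longrightarrow> distr (Q \<omega>) (borel_of (X I)) (\<lambda>x. \<phi> x I) = P I \<omega>"
      have "AE \<omega> in M. \<forall>I\<in>D. \<omega> \<in> \<Omega>t \<longrightarrow> distr (Q \<omega>) (borel_of (X I)) (\<lambda>x. \<phi> x I) = P I \<omega>"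
        using Qm by (subst AE_ball_countable[OF F.countable_index])
      then show "AE \<omega> in M. \<omega> \<in> \<Omega>t \<longrightarrow> Q \<omega> = Pt \<omega>"
        using F.AE_consistent
      proof eventually_elim
        fix \<omega> assume m: "\<forall>I\<in>D. \<omega> \<in> \<Omega>t \<longrightarrow> distr (Q \<omega>) (borel_of (X I)) (\<lambda>x. \<phi> x I) = P I \<omega>"
          and c: "\<omega> \<in> F.consistent"
        show "\<omega> \<in> \<Omega>t \<longrightarrow> Q \<omega> = Pt \<omega>"
        proof
          assume \<omega>: "\<omega> \<in> \<Omega>t"
          have Qs: "prob_space (Q \<omega>)" "sets (Q \<omega>) = sets (borel_of T)"
            using Q \<omega> by (auto simp: prob_kernel_def space_CDt)
          have "\<phi> \<in> Q \<omega> \<rightarrow>\<^sub>M borel_of XD" using \<phi>_meas measurable_cong_sets[OF Qs(2) refl] by blast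
          then have "prob_space (distr (Q \<omega>) (borel_of XD) \<phi>)" by (rule prob_space.prob_space_distr[OF Qs(1)])
          moreover have "sets (PD \<omega>) = sets (borel_of XD)" using PD_prob(2) \<omega> \<Omega>t_sub by blast
          moreover have "distr (distr (Q \<omega>) (borel_of XD) \<phi>) (borel_of (X I)) (\<lambda>x. x I)
              = distr (PD \<omega>) (borel_of (X I)) (\<lambda>x. x I)" if "I \<in> D" for I
            using marg[OF Qs(2) that] m \<omega> that PD_marg[OF c that] by simp
          ultimately have "distr (Q \<omega>) (borel_of XD) \<phi> = PD \<omega>"
            unfolding XD_def by (intro F.measure_on_XD_eqI) auto
          then show "Q \<omega> = Pt \<omega>" using Pt_lift[OF \<omega> c] Qs(2) by (simp add: lift_def)
        qed
      qed
    qed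
    show "\<forall>\<omega>\<in>\<Omega>t. radon_measure T (Pt \<omega>)"
    proof
      fix \<omega> assume \<omega>: "\<omega> \<in> \<Omega>t"
      show "radon_measure T (Pt \<omega>)"
        using Pt_lift[OF \<omega>] radon_measure_return[OF assms(8) t0[OF \<omega>]]
        by (cases "\<omega> \<in> F.consistent") (simp_all add: Pt_def lift_def)
    qed
    show "\<exists>PD. proj_lim_kernel M D r X f C P PD" using PD_lim by blast
    show "\<forall>PD'. proj_lim_kernel M D r X f C P PD' \<longrightarrow>
         (AE \<omega> in M. \<omega> \<in> \<Omega>t \<longrightarrow> is_pullback (topspace T) \<phi> (PD' \<omega>) (restr_to_subalg (Pt \<omega>) G))"
    proof (intro allI impI)
      fix PD' assume PD': "proj_lim_kernel M D r X f C P PD'"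
      have PD'k: "PD' \<in> CD \<rightarrow>\<^sub>M prob_algebra (borel_of XD)"
        using PD' by (simp add: proj_lim_kernel_def CD_def XD_def)
      show "AE \<omega> in M. \<omega> \<in> \<Omega>t \<longrightarrow> is_pullback (topspace T) \<phi> (PD' \<omega>) (restr_to_subalg (Pt \<omega>) G)"
        using F.proj_lim_kernel_AE[OF PD'] F.AE_consistent
      proof eventually_elim
        fix \<omega> assume m: "\<forall>I\<in>D. distr (PD' \<omega>) (borel_of (X I)) (\<lambda>x. x I) = P I \<omega>" and c: "\<omega> \<in> F.consistent"
        show "\<omega> \<in> \<Omega>t \<longrightarrow> is_pullback (topspace T) \<phi> (PD' \<omega>) (restr_to_subalg (Pt \<omega>) G)"
        proof
          assume \<omega>: "\<omega> \<in> \<Omega>t"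
          then have \<omega>M: "\<omega> \<in> space M" using \<Omega>t_sub by blast
          have eq: "PD' \<omega> = PD \<omega>"
            using kernel_sets[OF PD'k] PD_prob[OF \<omega>M] \<omega>M m PD_marg[OF c]
            by (intro F.measure_on_XD_eqI) (auto simp: CD_def F.space_CD XD_def)
          have sPD: "sets (PD \<omega>) = sets (borel_of XD)" by (rule PD_prob(2)[OF \<omega>M])
          interpret PD: prob_space "PD \<omega>" by (rule PD_prob(1)[OF \<omega>M])
          interpret Pt: prob_space "Pt \<omega>" by (rule Pt_prob(1)[OF \<omega>])
          have sub: "subalgebra (Pt \<omega>) G"
            using G_borel Pt_prob(2)[OF \<omega>] sets_eq_imp_space_eq[OF Pt_prob(2)[OF \<omega>]]
            by (simp add: subalgebra_def space_G)
          have "emeasure (PD \<omega>) (\<phi> ` topspace T) = emeasure (Pt \<omega>) (\<phi> -` \<phi> ` topspace T \<inter> topspace T)"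
            using Pt_PD[OF \<omega> c assms(11)] by simp
          also have "\<phi> -` \<phi> ` topspace T \<inter> topspace T = space (Pt \<omega>)"
            using sets_eq_imp_space_eq[OF Pt_prob(2)[OF \<omega>]] by auto
          finally have "emeasure (PD \<omega>) (\<phi> ` topspace T) = 1" by (simp add: Pt.emeasure_space_1)
          then have "outer_measure_of (PD \<omega>) (\<phi> ` topspace T) = emeasure (PD \<omega>) (space (PD \<omega>))"
            using assms(11) sPD by (simp add: outer_measure_of_eq PD.emeasure_space_1)
          moreover have "sets (restr_to_subalg (Pt \<omega>) G) = sets (vimage_algebra (topspace T) \<phi> (PD \<omega>))"
          proof -
            have "sets G = sets (vimage_algebra (topspace T) \<phi> (PD \<omega>))"
              unfolding G_def by (rule sets_vimage_algebra_cong[OF sPD[symmetric]])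
            then show ?thesis by (simp only: sets_restr_to_subalg[OF sub])
          qed
          moreover have "emeasure (restr_to_subalg (Pt \<omega>) G) (\<phi> -` B \<inter> topspace T) = emeasure (PD \<omega>) B"
            if "B \<in> sets (PD \<omega>)" for B
          proof -
            have B: "B \<in> sets (borel_of XD)" using that sPD by simp
            then have "\<phi> -` B \<inter> topspace T \<in> sets G" by (auto simp: sets_G)
            then show ?thesis using emeasure_restr_to_subalg[OF sub] Pt_PD[OF \<omega> c B] by simp
          qed
          ultimately show "is_pullback (topspace T) \<phi> (PD' \<omega>) (restr_to_subalg (Pt \<omega>) G)"
            unfolding is_pullback_def eq by blast
        qed
      qed
    qed
    show "\<forall>Z \<in> M \<rightarrow>\<^sub>M borel_of XD. (\<forall>I\<in>D. AE \<omega> in M. Z \<omega> I = Y I \<omega>) \<longrightarrow>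
         (\<forall>A\<in>sets G. AE \<omega> in M. \<omega> \<in> \<Omega>t \<longrightarrow>
            measure (Pt \<omega>) A = real_cond_exp M CD (indicator (Z -` (\<phi> ` A) \<inter> space M)) \<omega>)"
    proof (intro ballI impI)
      fix Z A assume Z: "Z \<in> M \<rightarrow>\<^sub>M borel_of XD" and ZY: "\<forall>I\<in>D. AE \<omega> in M. Z \<omega> I = Y I \<omega>" and A: "A \<in> sets G"
      obtain B where B: "B \<in> sets (borel_of XD)" "A = \<phi> -` B \<inter> topspace T" using A by (auto simp: sets_G)
      have "\<phi> ` A = B \<inter> \<phi> ` topspace T" using B by auto
      then have im: "\<phi> ` A \<in> sets (borel_of XD)" using B assms(11) by simp
      have pre: "\<phi> -` (\<phi> ` A) \<inter> topspace T = A"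
        using B(2) assms(10) by (auto simp: inj_on_def)
      have "AE \<omega> in M. measure (PD \<omega>) (\<phi> ` A) = real_cond_exp M CD (indicator (Z -` (\<phi> ` A) \<inter> space M)) \<omega>"
        using F.proj_lim_kernel_cond_prob[OF PD_lim] Z ZY im unfolding XD_def CD_def by blast
      then show "AE \<omega> in M. \<omega> \<in> \<Omega>t \<longrightarrow>
          measure (Pt \<omega>) A = real_cond_exp M CD (indicator (Z -` (\<phi> ` A) \<inter> space M)) \<omega>"
        using F.AE_consistent
      proof eventually_elim
        fix \<omega> assume e: "measure (PD \<omega>) (\<phi> ` A) = real_cond_exp M CD (indicator (Z -` (\<phi> ` A) \<inter> space M)) \<omega>"
          and c: "\<omega> \<in> F.consistent"
        show "\<omega> \<in> \<Omega>t \<longrightarrow> measure (Pt \<omega>) A = real_cond_exp M CD (indicator (Z -` (\<phi> ` A) \<inter> space M)) \<omega>"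
          using Pt_PD[OF _ c im] e by (simp add: pre measure_def)
      qed
    qed
  qed
qed

end
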